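(* Consider the function $$Q_0^{(n)}(\bar\sigma_j^2,\theta)=-N\log(\bar\sigma_j^2)-\frac1{\bar\sigma_j^2}\Big[w_j^\top w_j-2w_j^\top\mathbf W_{ji}\mathbf g_{ji}+\mathbf g_{ji}^\top\mathbf W_{ji}^\top\mathbf W_{ji}\mathbf g_{ji}-2w_j^\top\mathbf W\hat{\mathbf m}^{(n)}+2\mathbf g_{ji}^\top\mathbf W_{ji}^\top\mathbf W\hat{\mathbf m}^{(n)}+\mathrm{tr}\big(\mathbf W^\top\mathbf W\hat{\mathbf M}^{(n)}\big)\Big],$$ where $\mathbf g_{ji}$ and $\mathbf W$ depend on $\theta$; the update of $\theta$ is the maximizer of $Q_0^{(n)}$ with respect to $\theta$ (which does not depend on the value of $\bar\sigma_j^2$). The estimate of the parameter vector $\theta$ is updated by solving the quadratic problem $$\hat\theta^{(n+1)}=\arg\min_\theta\Big[\mathbf g_{ji}^\top\hat{\mathbf A}^{(n)}\mathbf g_{ji}-2\hat{\mathbf b}^{(n)\top}\mathbf g_{ji}\Big],$$ that has a closed form solution given by $$\hat\theta^{(n+1)}=\big(M^\top\hat{\mathbf A}^{(n)}M\big)^{-1}M^\top\hat{\mathbf b}^{(n)},$$ where $\hat{\mathbf A}^{(n)}$ and $\hat{\mathbf b}^{(n)}$ are computed using the current estimates $\hat{\mathbf m}^{(n)}$ and $\hat\eta^{(n)}$, and $\mathbf g_{ji}=M\theta$, where $M\in\mathbb R^{2N\times n_\theta}$ is a matrix with $1$ or $0$ as its elements. Explicitly, $$\hat{\mathbf A}^{(n)}=\begin{bmatrix}\hat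 A_{11}&\hat A_{12}\\ \hat A_{21}&\hat A_{22}\end{bmatrix}+\mathbf W_{ji}^\top\mathbf W_{ji}+2\mathbf W_{ji}^\top\hat{\mathbf Y}^{(n)},\qquad \hat{\mathbf b}^{(n)}=\begin{bmatrix}\hat b_{11}\\ \hat b_{12}\end{bmatrix}+\big[w_j^\top\mathbf W_{ji}+w_j^\top\hat{\mathbf Y}^{(n)}-\hat{\mathbf m}^{(n)\top}\mathbf X^\top\mathbf W_{ji}\big]^\top,$$ with $$\hat A_{11}=D_1^\top(\mathbf Z_i\hat{\mathbf M}^{(n)}\mathbf Z_i^\top\otimes I_N)D_1,\quad \hat A_{12}=D_1^\top(\mathbf Z_i\hat{\mathbf M}^{(n)}\mathbf Z_j^\top\otimes I_N)D_1,$$ $$\hat A_{21}=D_1^\top(\mathbf Z_j\hat{\mathbf M}^{(n)}\mathbf Z_i^\top\otimes I_N)D_1,\quad \hat A_{22}=D_1^\top(\mathbf Z_j\hat{\mathbf M}^{(n)}\mathbf Z_j^\top\otimes I_N)D_1,$$ $$\hat b_{11}=\Big[-\tfrac12\mathrm{vec}(\mathbf Z_i\hat{\mathbf M}^{(n)\top}\mathbf X^\top)^\top D_2-\tfrac12\mathrm{vec}(\mathbf X\hat{\mathbf M}^{(n)\top}\mathbf Z_i^\top)^\top D_1\Big]^\top,$$ $$\hat b_{12}=\Big[-\tfrac12\mathrm{vec}(\mathbf Z_j\hat{\mathbf M}^{(n)\top}\mathbf X^\top)^\top D_2-\tfrac12\mathrm{vec}(\mathbf X\hat{\mathbf M}^{(n)\top}\mathbf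 Z_j^\top)^\top D_1\Big]^\top.$$
   Context: $N,l$ are positive integers. $j$ is the output node, $\mathcal N_j\not\ni j$ is a finite set of input node indices, $i\in\mathcal N_j$, and $\mathcal N_j\setminus\{i\}=\{k_1,\dots,k_p\}$. Measured signals $w_k(t)$, $t=1,\dots,N$, are given; $w_j=[w_j(1)\ \dots\ w_j(N)]^\top$. For $x\in\mathbb R^N$ the $N\times r$ Toeplitz matrix of $x$ has $(s,t)$ entry $x_{s-t+1}$ if $s\ge t$ and $0$ otherwise. $W_k$ is the $N\times l$ Toeplitz matrix of $[0\ w_k(1)\ \dots\ w_k(N-1)]^\top$ for $k\in(\mathcal N_j\cup\{j\})\setminus\{i\}$; for $\ell\in\{i,j\}$, $W_\ell^N$ is the $N\times N$ Toeplitz matrix of $[0\ w_\ell(1)\ \dots\ w_\ell(N-1)]^\top$, and $\overleftrightarrow W_\ell$, $\overleftrightarrow W_\ell^N$ are the $N\times l$ and $N\times N$ Toeplitz matrices of $[0\ 0\ -w_\ell(1)\ \dots\ -w_\ell(N-2)]^\top$. For $\theta=[\theta_B^\top\ \theta_F^\top]^\top\in\mathbb R^{n_\theta}$ (coefficients of the numerator and of the denominator minus one of the target module $G_{ji}$) put $b_{ji}=[\theta_B^\top\ 0^\top]^\top$, $f_{ji}=[\theta_F^\top\ 0^\top]^\top\in\mathbb R^N$, $\mathbf g_{ji}=[b_{ji}^\top\ f_{ji}^\top]^\top$, let $G_b,G_f$ be the $N\times N$ Toeplitz matrices of $b_{ji},f_{ji}$, and $\tilde W=W_j+G_b\overleftrightarrow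 W_i-G_f\overleftrightarrow W_j$, $\mathbf W_{ji}=[W_i^N\ \ -W_j^N]$, $\mathbf W=[\tilde W\ W_{k_1}\ \dots\ W_{k_p}]$. Kernel: $K_\beta\in\mathbb R^{l\times l}$, $[K_\beta]_{x,y}=\beta^{\max(x,y)}$, with hyperparameters $\beta\in[0,1)$ and scalings $\lambda\ge0$. The model is $w_j=\mathbf W\mathbf m+\mathbf W_{ji}\mathbf g_{ji}+\bar e_j$, with $\mathbf m=[m_j^\top\ m_{k_1}^\top\dots m_{k_p}^\top]^\top\sim\mathcal N(0,\mathbf K)$, $\mathbf K=\mathrm{diag}\{\lambda_jK_{\beta_j},\lambda_{k_1}K_{\beta_{k_1}},\dots,\lambda_{k_p}K_{\beta_{k_p}}\}$, and $\bar e_j$ Gaussian white noise of variance $\bar\sigma_j^2$; $\mathbf m$ and $w_j$ are treated as jointly Gaussian with $\mathbf W,\mathbf W_{ji}$ as given matrices and cross-covariance $\mathbf K\mathbf W^\top$. The vector $\eta$ collects $\theta$, all $\lambda$'s, all $\beta$'s and $\bar\sigma_j^2$, and is estimated by maximizing the marginal likelihood of $w_j$ with the Expectation-Maximization algorithm, $\mathbf m$ being the latent variable; $Q_0^{(n)}$ is the part of the expected joint log-likelihood (up to constants and a factor 2) depending on $\theta$ and $\bar\sigma_j^2$. The posterior of $\mathbf m$ given $w_j$ is Gaussian with covariance $\mathbf P_m=(\mathbf W^\top\mathbf W/\bar\sigma_j^2+\mathbf K^{-1})^{-1}$ and mean $\mathbf P_m\mathbf W^\top(w_j-\mathbf W_{ji}\mathbf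 g_{ji})/\bar\sigma_j^2$. For the estimate $\hat\eta^{(n)}$ at iteration $n$, $\hat{\mathbf P}_m^{(n)}$ and $\hat{\mathbf m}^{(n)}$ are this covariance and mean evaluated at $\eta=\hat\eta^{(n)}$, and $\hat{\mathbf M}^{(n)}=\hat{\mathbf P}_m^{(n)}+\hat{\mathbf m}^{(n)}\hat{\mathbf m}^{(n)\top}$; they do not depend on the optimization variable $\theta$. Further notation: $D_1,D_2\in\mathbb R^{N^2\times N}$ are the matrices such that for every $x\in\mathbb R^N$ with $N\times N$ Toeplitz matrix $T$, $D_1x=\mathrm{vec}(T)$ and $D_2x=\mathrm{vec}(T^\top)$ (vec stacks columns). $\breve m^{(n)}\in\mathbb R^N$ consists of the first $N$ entries of $\hat m_j^{(n)}$ (the first $l$-block of $\hat{\mathbf m}^{(n)}$) if $N\le l$, and of $\hat m_j^{(n)}$ padded with zeros if $N>l$; $\breve M^{(n)}$ is its $N\times N$ Toeplitz matrix. $\mathbf X=[W_j\ W_{k_1}\ \dots\ W_{k_p}]$, $\hat{\mathbf Y}^{(n)}=\breve M^{(n)}[\overleftrightarrow W_i^N\ \ -\overleftrightarrow W_j^N]$, $\mathbf Z_i=[\overleftrightarrow W_i\ 0\ \dots\ 0]$, $\mathbf Z_j=[-\overleftrightarrow W_j\ 0\ \dots\ 0]$, both in $\mathbb R^{N\times(p+1)l}$.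
   Formalization: The printed closed form fails in general because is not symmetric; it is stated with the symmetric part of MᵀÂM inverted, and as printed when MᵀÂM is symmetric. The inverted matrix and K at the current estimate are assumed invertible; θ_B and θ_F have length at most N. *)

theory Defs
  imports Complex_Main "Jordan_Normal_Form.Gauss_Jordan_Elimination"
begin

text \<open>Vectors and matrices are those of Jordan_Normal_Form, hence indexed from 0.\<close>

definition resize_vec :: "nat \<Rightarrow> real vec \<Rightarrow> real vec" where
  "resize_vec N x = vec N (\<lambda>s. if s < dim_vec x then x $ s else 0)"

definition toeplitz :: "nat \<Rightarrow> real vec \<Rightarrow> real mat" where
  "toeplitz r x = mat (dim_vec x) r (\<lambda>(s, t). if t \<le> s then x $ (s - t) else 0)"

text \<open>\<open>block_row n [A\<^sub>1, \<dots>, A\<^sub>q]\<close> is \<open>[A\<^sub>1 \<dots> A\<^sub>q]\<close>, where all blocks have \<open>n\<close> rows.\<close>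

fun block_row :: "nat \<Rightarrow> real mat list \<Rightarrow> real mat" where
  "block_row n [] = 0\<^sub>m n 0"
| "block_row n (A # As) =
     four_block_mat A (block_row n As) (0\<^sub>m 0 (dim_col A)) (0\<^sub>m 0 (dim_col (block_row n As)))"

definition vec_cols :: "real mat \<Rightarrow> real vec" where
  "vec_cols A = vec (dim_row A * dim_col A) (\<lambda>q. A $$ (q mod dim_row A, q div dim_row A))"

definition kron :: "real mat \<Rightarrow> real mat \<Rightarrow> real mat" where
  "kron A B = mat (dim_row A * dim_row B) (dim_col A * dim_col B)
     (\<lambda>(r, c). A $$ (r div dim_row B, c div dim_col B) * B $$ (r mod dim_row B, c mod dim_col B))"

definition mat_trace :: "real mat \<Rightarrow> real" where
  "mat_trace A = (\<Sum>r<dim_row A. A $$ (r, r))"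

definition outer_prod :: "real vec \<Rightarrow> real mat" where
  "outer_prod v = mat (dim_vec v) (dim_vec v) (\<lambda>(r, c). v $ r * v $ c)"

text \<open>Meaningful only for invertible arguments.\<close>

definition minv :: "real mat \<Rightarrow> real mat" where
  "minv A = the (mat_inverse A)"

text \<open>
  The matrix \<open>A_hat\<close> below is in general not symmetric, because of its summand
  \<open>2 \<cdot>\<^sub>m ((W_ji S)\<^sup>T * Y_hat S \<eta>)\<close>, and neither is \<open>M\<^sup>T * A_hat S \<eta> * M\<close>. Only the symmetric
  part enters the quadratic form, hence also the normal equations of the quadratic problem.
\<close>

definition sym_part :: "real mat \<Rightarrow> real mat" where
  "sym_part A = (1 / 2) \<cdot>\<^sub>m (A + A\<^sup>T)"

definition D1 :: "nat \<Rightarrow> real mat" where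
  "D1 N = mat_of_cols (N * N) (map (\<lambda>c. vec_cols (toeplitz N (unit_vec N c))) [0..<N])"

definition D2 :: "nat \<Rightarrow> real mat" where
  "D2 N = mat_of_cols (N * N) (map (\<lambda>c. vec_cols ((toeplitz N (unit_vec N c))\<^sup>T)) [0..<N])"

lemma D1_carrier: "D1 N \<in> carrier_mat (N * N) N"
  and D2_carrier: "D2 N \<in> carrier_mat (N * N) N"
  by (auto simp: D1_def D2_def)

lemma D1_mult_vec:
  assumes x: "x \<in> carrier_vec N"
  shows "D1 N *\<^sub>v x = vec_cols (toeplitz N x)"
proof (rule eq_vecI)
  fix q assume "q < dim_vec (vec_cols (toeplitz N x))"
  hence q: "q < N * N" using x by (simp add: vec_cols_def toeplitz_def)
  hence N: "0 < N" by (cases N) auto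
  have m: "q mod N < N" "q div N < N" using q N by (auto simp: less_mult_imp_div_less)
  have m2: "q mod N - q div N < N" "q div N - q mod N < N" using m by linarith+
  have "(D1 N *\<^sub>v x) $ q = (\<Sum>c = 0..<N. D1 N $$ (q, c) * x $ c)"
    using q x by (simp add: D1_def scalar_prod_def)
  also have "\<dots> = (\<Sum>c = 0..<N. if c = q mod N - q div N then
      (if q div N \<le> q mod N then x $ c else 0) else 0)"
    using q m m2 by (intro sum.cong)
      (auto simp: D1_def mat_of_cols_index vec_cols_def toeplitz_def unit_vec_def)
  also have "\<dots> = vec_cols (toeplitz N x) $ q"
    using q m m2 x by (auto simp: vec_cols_def toeplitz_def)
  finally show "(D1 N *\<^sub>v x) $ q = vec_cols (toeplitz N x) $ q" .
qed (use x in \<open>auto simp: D1_def vec_cols_def toeplitz_def\<close>)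

lemma D2_mult_vec:
  assumes x: "x \<in> carrier_vec N"
  shows "D2 N *\<^sub>v x = vec_cols ((toeplitz N x)\<^sup>T)"
proof (rule eq_vecI)
  fix q assume "q < dim_vec (vec_cols ((toeplitz N x)\<^sup>T))"
  hence q: "q < N * N" using x by (simp add: vec_cols_def toeplitz_def)
  hence N: "0 < N" by (cases N) auto
  have m: "q mod N < N" "q div N < N" using q N by (auto simp: less_mult_imp_div_less)
  have m2: "q mod N - q div N < N" "q div N - q mod N < N" using m by linarith+
  have "(D2 N *\<^sub>v x) $ q = (\<Sum>c = 0..<N. D2 N $$ (q, c) * x $ c)"
    using q x by (simp add: D2_def scalar_prod_def)
  also have "\<dots> = (\<Sum>c = 0..<N. if c = q div N - q mod N then
      (if q mod N \<le> q div N then x $ c else 0) else 0)"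
    using q m m2 by (intro sum.cong)
      (auto simp: D2_def mat_of_cols_index vec_cols_def toeplitz_def unit_vec_def)
  also have "\<dots> = vec_cols ((toeplitz N x)\<^sup>T) $ q"
    using q m m2 x by (auto simp: vec_cols_def toeplitz_def)
  finally show "(D2 N *\<^sub>v x) $ q = vec_cols ((toeplitz N x)\<^sup>T) $ q" .
qed (use x in \<open>auto simp: D2_def vec_cols_def toeplitz_def\<close>)

text \<open>
  The identification setup: \<open>nsamp\<close> is \<open>N\<close>, \<open>irlen\<close> is \<open>l\<close>, \<open>nnum\<close> and \<open>nden\<close> are the lengths of
  the numerator and denominator parameter vectors \<open>\<theta>\<^sub>B\<close> and \<open>\<theta>\<^sub>F\<close>, \<open>outn\<close> and \<open>inn\<close> are the
  output node \<open>j\<close> and the input node \<open>i\<close> of the target module, \<open>others\<close> is \<open>[k\<^sub>1, \<dots>, k\<^sub>p]\<close>, and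
  \<open>sig k t\<close> is \<open>w\<^sub>k(t)\<close>, of which only \<open>t = 1, \<dots>, N\<close> are used.
\<close>

record 'v setup_data =
  nsamp :: nat
  irlen :: nat
  nnum :: nat
  nden :: nat
  outn :: 'v
  inn :: 'v
  others :: "'v list"
  sig :: "'v \<Rightarrow> nat \<Rightarrow> real"

text \<open>The vector \<open>\<eta>\<close>; the scalings and kernel parameters are indexed by \<open>j, k\<^sub>1, \<dots>, k\<^sub>p\<close>.\<close>

record 'v hyperparams =
  theta :: "real vec"
  lam :: "'v \<Rightarrow> real"
  bet :: "'v \<Rightarrow> real"
  sigma2 :: real

definition n_theta :: "'v setup_data \<Rightarrow> nat" where
  "n_theta S = nnum S + nden S"

definition w_out :: "'v setup_data \<Rightarrow> real vec" where
  "w_out S = vec (nsamp S) (\<lambda>s. sig S (outn S) (s + 1))"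

text \<open>\<open>[0 w\<^sub>k(1) \<dots> w\<^sub>k(N-1)]\<close> and \<open>[0 0 -w\<^sub>k(1) \<dots> -w\<^sub>k(N-2)]\<close>.\<close>

definition delay1 :: "'v setup_data \<Rightarrow> 'v \<Rightarrow> real vec" where
  "delay1 S k = vec (nsamp S) (\<lambda>s. if s = 0 then 0 else sig S k s)"

definition delay2 :: "'v setup_data \<Rightarrow> 'v \<Rightarrow> real vec" where
  "delay2 S k = vec (nsamp S) (\<lambda>s. if s \<le> 1 then 0 else - sig S k (s - 1))"

definition W_node :: "'v setup_data \<Rightarrow> 'v \<Rightarrow> real mat" where
  "W_node S k = toeplitz (irlen S) (delay1 S k)"

definition W_nodeN :: "'v setup_data \<Rightarrow> 'v \<Rightarrow> real mat" where
  "W_nodeN S k = toeplitz (nsamp S) (delay1 S k)"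

text \<open>The matrices written with a double-headed arrow over \<open>W\<close>.\<close>

definition W_arrow :: "'v setup_data \<Rightarrow> 'v \<Rightarrow> real mat" where
  "W_arrow S k = toeplitz (irlen S) (delay2 S k)"

definition W_arrowN :: "'v setup_data \<Rightarrow> 'v \<Rightarrow> real mat" where
  "W_arrowN S k = toeplitz (nsamp S) (delay2 S k)"

definition b_ji :: "'v setup_data \<Rightarrow> real vec \<Rightarrow> real vec" where
  "b_ji S \<theta> = resize_vec (nsamp S) (vec_first \<theta> (nnum S))"

definition f_ji :: "'v setup_data \<Rightarrow> real vec \<Rightarrow> real vec" where
  "f_ji S \<theta> = resize_vec (nsamp S) (vec_last \<theta> (nden S))"

definition g_ji :: "'v setup_data \<Rightarrow> real vec \<Rightarrow> real vec" where
  "g_ji S \<theta> = b_ji S \<theta> @\<^sub>v f_ji S \<theta>"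

definition W_tilde :: "'v setup_data \<Rightarrow> real vec \<Rightarrow> real mat" where
  "W_tilde S \<theta> = W_node S (outn S)
     + toeplitz (nsamp S) (b_ji S \<theta>) * W_arrow S (inn S)
     - toeplitz (nsamp S) (f_ji S \<theta>) * W_arrow S (outn S)"

definition W_ji :: "'v setup_data \<Rightarrow> real mat" where
  "W_ji S = block_row (nsamp S) [W_nodeN S (inn S), - W_nodeN S (outn S)]"

definition W_mat :: "'v setup_data \<Rightarrow> real vec \<Rightarrow> real mat" where
  "W_mat S \<theta> = block_row (nsamp S) (W_tilde S \<theta> # map (W_node S) (others S))"

definition X_mat :: "'v setup_data \<Rightarrow> real mat" where
  "X_mat S = block_row (nsamp S) (W_node S (outn S) # map (W_node S) (others S))"

definition Z_i :: "'v setup_data \<Rightarrow> real mat" where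
  "Z_i S = block_row (nsamp S)
     (W_arrow S (inn S) # replicate (length (others S)) (0\<^sub>m (nsamp S) (irlen S)))"

definition Z_j :: "'v setup_data \<Rightarrow> real mat" where
  "Z_j S = block_row (nsamp S)
     (- W_arrow S (outn S) # replicate (length (others S)) (0\<^sub>m (nsamp S) (irlen S)))"

definition kernel :: "nat \<Rightarrow> real \<Rightarrow> real mat" where
  "kernel l \<beta> = mat l l (\<lambda>(x, y). \<beta> ^ max (x + 1) (y + 1))"

definition K_mat :: "'v setup_data \<Rightarrow> 'v hyperparams \<Rightarrow> real mat" where
  "K_mat S \<eta> = diag_block_mat
     (map (\<lambda>k. lam \<eta> k \<cdot>\<^sub>m kernel (irlen S) (bet \<eta> k)) (outn S # others S))"

definition P_post :: "'v setup_data \<Rightarrow> 'v hyperparams \<Rightarrow> real mat" where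
  "P_post S \<eta> = minv ((1 / sigma2 \<eta>) \<cdot>\<^sub>m ((W_mat S (theta \<eta>))\<^sup>T * W_mat S (theta \<eta>))
     + minv (K_mat S \<eta>))"

definition m_post :: "'v setup_data \<Rightarrow> 'v hyperparams \<Rightarrow> real vec" where
  "m_post S \<eta> = (1 / sigma2 \<eta>) \<cdot>\<^sub>v (P_post S \<eta> *\<^sub>v
     ((W_mat S (theta \<eta>))\<^sup>T *\<^sub>v (w_out S - W_ji S *\<^sub>v g_ji S (theta \<eta>))))"

definition M_post :: "'v setup_data \<Rightarrow> 'v hyperparams \<Rightarrow> real mat" where
  "M_post S \<eta> = P_post S \<eta> + outer_prod (m_post S \<eta>)"

definition m_breve :: "'v setup_data \<Rightarrow> 'v hyperparams \<Rightarrow> real vec" where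
  "m_breve S \<eta> = resize_vec (nsamp S) (vec_first (m_post S \<eta>) (irlen S))"

definition Y_hat :: "'v setup_data \<Rightarrow> 'v hyperparams \<Rightarrow> real mat" where
  "Y_hat S \<eta> = toeplitz (nsamp S) (m_breve S \<eta>)
     * block_row (nsamp S) [W_arrowN S (inn S), - W_arrowN S (outn S)]"

text \<open>In the following, \<open>\<eta>\<close> is the current estimate, which enters only through the posterior
  moments; \<open>s\<close> and \<open>\<theta>\<close> are the optimization variables.\<close>

definition Q0 :: "'v setup_data \<Rightarrow> 'v hyperparams \<Rightarrow> real \<Rightarrow> real vec \<Rightarrow> real" where
  "Q0 S \<eta> s \<theta> = - real (nsamp S) * ln s - 1 / s *
     (w_out S \<bullet> w_out S
      - 2 * (w_out S \<bullet> (W_ji S *\<^sub>v g_ji S \<theta>))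
      + g_ji S \<theta> \<bullet> (((W_ji S)\<^sup>T * W_ji S) *\<^sub>v g_ji S \<theta>)
      - 2 * (w_out S \<bullet> (W_mat S \<theta> *\<^sub>v m_post S \<eta>))
      + 2 * (g_ji S \<theta> \<bullet> (((W_ji S)\<^sup>T * W_mat S \<theta>) *\<^sub>v m_post S \<eta>))
      + mat_trace ((W_mat S \<theta>)\<^sup>T * W_mat S \<theta> * M_post S \<eta>))"

definition A_block :: "'v setup_data \<Rightarrow> 'v hyperparams \<Rightarrow> real mat \<Rightarrow> real mat \<Rightarrow> real mat" where
  "A_block S \<eta> Z Z' =
     (D1 (nsamp S))\<^sup>T * kron (Z * M_post S \<eta> * Z'\<^sup>T) (1\<^sub>m (nsamp S)) * D1 (nsamp S)"

definition A_hat :: "'v setup_data \<Rightarrow> 'v hyperparams \<Rightarrow> real mat" where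
  "A_hat S \<eta> = four_block_mat
       (A_block S \<eta> (Z_i S) (Z_i S)) (A_block S \<eta> (Z_i S) (Z_j S))
       (A_block S \<eta> (Z_j S) (Z_i S)) (A_block S \<eta> (Z_j S) (Z_j S))
     + (W_ji S)\<^sup>T * W_ji S + 2 \<cdot>\<^sub>m ((W_ji S)\<^sup>T * Y_hat S \<eta>)"

text \<open>The vector \<open>b\<close> is a column, so the transposes of its row-vector summands are carried out.\<close>

definition b_block :: "'v setup_data \<Rightarrow> 'v hyperparams \<Rightarrow> real mat \<Rightarrow> real vec" where
  "b_block S \<eta> Z =
     (- 1 / 2) \<cdot>\<^sub>v ((D2 (nsamp S))\<^sup>T *\<^sub>v vec_cols (Z * (M_post S \<eta>)\<^sup>T * (X_mat S)\<^sup>T))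
     - (1 / 2) \<cdot>\<^sub>v ((D1 (nsamp S))\<^sup>T *\<^sub>v vec_cols (X_mat S * (M_post S \<eta>)\<^sup>T * Z\<^sup>T))"

definition b_hat :: "'v setup_data \<Rightarrow> 'v hyperparams \<Rightarrow> real vec" where
  "b_hat S \<eta> = (b_block S \<eta> (Z_i S) @\<^sub>v b_block S \<eta> (Z_j S))
     + ((W_ji S)\<^sup>T *\<^sub>v w_out S + (Y_hat S \<eta>)\<^sup>T *\<^sub>v w_out S
        - (W_ji S)\<^sup>T *\<^sub>v (X_mat S *\<^sub>v m_post S \<eta>))"

definition quad_cost :: "'v setup_data \<Rightarrow> 'v hyperparams \<Rightarrow> real vec \<Rightarrow> real" where
  "quad_cost S \<eta> \<theta> =
     g_ji S \<theta> \<bullet> (A_hat S \<eta> *\<^sub>v g_ji S \<theta>) - 2 * (b_hat S \<eta> \<bullet> g_ji S \<theta>)"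

end

theory Submission
  imports Defs "Jordan_Normal_Form.Determinant" "HOL-Computational_Algebra.Formal_Power_Series"
begin

text \<open>
  Since \<open>\<theta>\<close> enters \<open>\<bold>W = \<bold>X + G\<^sub>b \<bold>Z\<^sub>i + G\<^sub>f \<bold>Z\<^sub>j\<close> affinely, and lower triangular Toeplitz matrices
  commute (they are multiplications of truncated power series), the bracket in \<open>Q\<^sub>0\<close> equals the
  quadratic cost plus a term that does not depend on \<open>\<theta>\<close>. The bracket is also the posterior
  expectation of \<open>\<parallel>w\<^sub>j - \<bold>W\<bold>m - \<bold>W\<^sub>j\<^sub>i\<bold>g\<^sub>j\<^sub>i\<parallel>\<^sup>2\<close>, that is, the squared residual at the posterior mean plus
  \<open>tr(\<bold>W \<bold>P \<bold>W\<^sup>T)\<close>, hence nonnegative. So the quadratic cost is bounded below, which forces the symmetric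
  part of its matrix to be positive semidefinite; the minimizers are then exactly the solutions
  of the normal equations.
\<close>

subsection \<open>Matrices\<close>

lemma invertible_mat_if_kernel_trivial:
  fixes A :: "real mat"
  assumes A: "A \<in> carrier_mat n n"
    and ker: "\<And>v. v \<in> carrier_vec n \<Longrightarrow> A *\<^sub>v v = 0\<^sub>v n \<Longrightarrow> v = 0\<^sub>v n"
  shows "invertible_mat A"
proof -
  have "det A \<noteq> 0" using det_0_iff_vec_prod_zero_field[OF A] ker by blast
  from det_non_zero_imp_unit[OF A this, where b = "()"]
  obtain B where "B \<in> carrier_mat n n" "B * A = 1\<^sub>m n" "A * B = 1\<^sub>m n"
    unfolding Units_def ring_mat_def by auto
  with A show ?thesis unfolding invertible_mat_def inverts_mat_def by auto
qed

lemma minv_inverse: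
  assumes A: "A \<in> carrier_mat n n" and inv: "invertible_mat A"
  shows "minv A \<in> carrier_mat n n" "A * minv A = 1\<^sub>m n" "minv A * A = 1\<^sub>m n"
proof -
  obtain B where B: "A * B = 1\<^sub>m n" "B * A = 1\<^sub>m (dim_row B)"
    using inv A unfolding invertible_mat_def inverts_mat_def by auto
  \<comment> \<open>\<open>invertible_mat\<close> does not fix the dimensions of its witness
    \<open>B\<close>; they are read off from the two identity matrices. Only then is
    \<open>A\<close> seen to be a unit of the matrix ring, so that \<open>mat_inverse\<close>
    returns \<open>Some\<close>.\<close>
  have "dim_col B = n" using B(1) by (metis index_mult_mat(3) index_one_mat(3))
  moreover have "dim_row B = n" using B(2) A
    by (metis index_mult_mat(3) index_one_mat(3) carrier_matD(2))
  ultimately have Bc: "B \<in> carrier_mat n n" by auto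
  have "A \<in> Units (ring_mat TYPE(real) n ())"
    using A B Bc unfolding Units_def ring_mat_def by auto
  then obtain C where C: "mat_inverse A = Some C" using mat_inverse(1)[OF A] by fastforce
  show "minv A \<in> carrier_mat n n" "A * minv A = 1\<^sub>m n" "minv A * A = 1\<^sub>m n"
    using mat_inverse(2)[OF A C] by (simp_all add: minv_def C)
qed

text \<open>Only the sign of the quadratic form is recorded. This passes to inverses and to block
  diagonal matrices, which carries it from the kernels to the posterior covariance.\<close>

definition psd_mat :: "real mat \<Rightarrow> bool" where
  "psd_mat A \<longleftrightarrow> (\<forall>v \<in> carrier_vec (dim_row A). 0 \<le> v \<bullet> (A *\<^sub>v v))"

lemma psd_matD: "psd_mat A \<Longrightarrow> A \<in> carrier_mat n n \<Longrightarrow> v \<in> carrier_vec n \<Longrightarrow> 0 \<le> v \<bullet> (A *\<^sub>v v)"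
  by (simp add: psd_mat_def)

lemma scalar_prod_self_nonneg: "0 \<le> (v :: real vec) \<bullet> v"
  by (simp add: scalar_prod_def sum_nonneg)

lemma scalar_prod_self_eq_0:
  fixes v :: "real vec"
  assumes "v \<bullet> v = 0" "v \<in> carrier_vec n"
  shows "v = 0\<^sub>v n"
  using assms by (auto simp: scalar_prod_def sum_nonneg_eq_0_iff)

text \<open>The form of \<open>B\<close> at \<open>v\<close> is the form of \<open>A\<close> at
  \<open>B *\<^sub>v v\<close>.\<close>

lemma psd_right_inverse:
  assumes A: "A \<in> carrier_mat n n" and B: "B \<in> carrier_mat n n" and AB: "A * B = 1\<^sub>m n"
    and psd: "psd_mat A"
  shows "psd_mat B"
  unfolding psd_mat_def
proof
  fix v :: "real vec" assume "v \<in> carrier_vec (dim_row B)"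
  hence v: "v \<in> carrier_vec n" using B by simp
  have Bv: "B *\<^sub>v v \<in> carrier_vec n" using B v by simp
  have "A *\<^sub>v (B *\<^sub>v v) = v" using A B v AB by (metis assoc_mult_mat_vec one_mult_mat_vec)
  hence "v \<bullet> (B *\<^sub>v v) = (B *\<^sub>v v) \<bullet> (A *\<^sub>v (B *\<^sub>v v))" using comm_scalar_prod[OF v Bv] by simp
  thus "0 \<le> v \<bullet> (B *\<^sub>v v)" using psd_matD[OF psd A Bv] by simp
qed

text \<open>The quadratic form splits into those of the blocks. The dimensions are carried through
  the same induction because cutting the vector needs the size of the tail.\<close>

lemma psd_diag_block_mat:
  assumes "\<And>A. A \<in> set As \<Longrightarrow> psd_mat A \<and> A \<in> carrier_mat n n"
  shows "psd_mat (diag_block_mat As) \<and>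
    diag_block_mat As \<in> carrier_mat (length As * n) (length As * n)"
  using assms
proof (induction As)
  case Nil
  then show ?case by (auto simp: psd_mat_def scalar_prod_def)
next
  case (Cons A As)
  let ?q = "length As * n" and ?B = "diag_block_mat As"
  have A: "A \<in> carrier_mat n n" "psd_mat A" and B: "?B \<in> carrier_mat ?q ?q" "psd_mat ?B"
    using Cons by auto
  have eq: "diag_block_mat (A # As) = four_block_mat A (0\<^sub>m n ?q) (0\<^sub>m ?q n) ?B"
    using A B by (simp add: Let_def)
  have c: "diag_block_mat (A # As) \<in> carrier_mat (n + ?q) (n + ?q)"
    unfolding eq using A B by auto
  have "0 \<le> v \<bullet> (diag_block_mat (A # As) *\<^sub>v v)" if v: "v \<in> carrier_vec (n + ?q)" for v
  proof -
    let ?x = "vec_first v n" and ?y = "vec_last v ?q"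
    have xy: "?x \<in> carrier_vec n" "?y \<in> carrier_vec ?q" by auto
    have "diag_block_mat (A # As) *\<^sub>v (?x @\<^sub>v ?y) = (A *\<^sub>v ?x) @\<^sub>v (?B *\<^sub>v ?y)"
      unfolding eq using A B xy by (subst four_block_mat_mult_vec) auto
    hence "(?x @\<^sub>v ?y) \<bullet> (diag_block_mat (A # As) *\<^sub>v (?x @\<^sub>v ?y))
        = ?x \<bullet> (A *\<^sub>v ?x) + ?y \<bullet> (?B *\<^sub>v ?y)"
      using A B xy by (simp add: scalar_prod_append[where ?n1.0 = n and ?n2.0 = ?q])
    thus ?thesis using psd_matD[OF A(2,1) xy(1)] psd_matD[OF B(2,1) xy(2)] v by simp
  qed
  thus ?case using c by (auto simp: psd_mat_def)
qed

section \<open>Trace, vectorization and Kronecker products\<close>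

lemma mat_trace_comm:
  assumes "A \<in> carrier_mat n m" "B \<in> carrier_mat m n"
  shows "mat_trace (A * B) = mat_trace (B * A)"
proof -
  have "mat_trace (A * B) = (\<Sum>i<n. \<Sum>j<m. A $$ (i, j) * B $$ (j, i))"
    using assms by (simp add: mat_trace_def scalar_prod_def atLeast0LessThan)
  also have "\<dots> = (\<Sum>j<m. \<Sum>i<n. B $$ (j, i) * A $$ (i, j))"
    by (subst sum.swap) (simp add: mult.commute)
  also have "\<dots> = mat_trace (B * A)"
    using assms by (simp add: mat_trace_def scalar_prod_def atLeast0LessThan)
  finally show ?thesis .
qed

lemma mat_trace_add:
  "A \<in> carrier_mat n n \<Longrightarrow> B \<in> carrier_mat n n \<Longrightarrow> mat_trace (A + B) = mat_trace A + mat_trace B"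
  by (simp add: mat_trace_def sum.distrib)

lemma vec_cols_carrier: "A \<in> carrier_mat n m \<Longrightarrow> vec_cols A \<in> carrier_vec (m * n)"
  by (simp add: vec_cols_def mult.commute)

lemma mod_div_less:
  fixes q :: nat
  assumes "q < m * n"
  shows "q mod n < n" "q div n < m"
  using assms by (cases "n = 0"; auto simp: less_mult_imp_div_less)+

text \<open>Column stacking puts entry (i, j) at position \<open>j * n + i\<close>, so a sum over a
  vectorized matrix becomes a double sum over its entries.\<close>

lemma sum_mod_div:
  "(\<Sum>q<m * n. f (q mod n) (q div n)) = (\<Sum>j<m. \<Sum>i<n. f i j)" for m n :: nat
proof -
  have "(\<Sum>q<m * n. f (q mod n) (q div n))
      = (\<Sum>j<m. \<Sum>q\<in>{j * n..<j * n + n}. f (q mod n) (q div n))"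
    by (rule sum.nat_group[symmetric])
  also have "\<dots> = (\<Sum>j<m. \<Sum>i<n. f i j)"
  proof (rule sum.cong[OF refl])
    fix j
    have "(\<Sum>q\<in>{j * n..<j * n + n}. f (q mod n) (q div n))
        = (\<Sum>i\<in>{0..<n}. f ((i + j * n) mod n) ((i + j * n) div n))"
      using sum.shift_bounds_nat_ivl[of "\<lambda>q. f (q mod n) (q div n)" 0 "j * n" n]
      by (simp add: add.commute)
    also have "\<dots> = (\<Sum>i<n. f i j)" by (auto intro!: sum.cong)
    finally show "(\<Sum>q\<in>{j * n..<j * n + n}. f (q mod n) (q div n)) = (\<Sum>i<n. f i j)" .
  qed
  finally show ?thesis .
qed

text \<open>Both sides are the Frobenius inner product of \<open>A\<close> and
  \<open>B\<close>.\<close>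

lemma scalar_prod_vec_cols:
  assumes "A \<in> carrier_mat n m" "B \<in> carrier_mat n m"
  shows "vec_cols A \<bullet> vec_cols B = mat_trace (A\<^sup>T * B)"
proof -
  have "vec_cols A \<bullet> vec_cols B
      = (\<Sum>q<m * n. A $$ (q mod n, q div n) * B $$ (q mod n, q div n))"
    using assms by (simp add: scalar_prod_def vec_cols_def atLeast0LessThan mult.commute)
  also have "\<dots> = (\<Sum>j<m. \<Sum>i<n. A $$ (i, j) * B $$ (i, j))"
    by (rule sum_mod_div[of "\<lambda>i j. A $$ (i, j) * B $$ (i, j)"])
  also have "\<dots> = mat_trace (A\<^sup>T * B)"
    using assms by (simp add: mat_trace_def scalar_prod_def atLeast0LessThan)
  finally show ?thesis .
qed

text \<open>The case of an identity left factor in the classical rule that turns a two-sided matrix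
  product into a Kronecker product acting on the vectorization.\<close>

lemma kron_one_mult_vec_cols:
  assumes B: "B \<in> carrier_mat k m" and T: "T \<in> carrier_mat n m"
  shows "kron B (1\<^sub>m n) *\<^sub>v vec_cols T = vec_cols (T * B\<^sup>T)"
proof (rule eq_vecI)
  fix r assume "r < dim_vec (vec_cols (T * B\<^sup>T))"
  hence r: "r < k * n" using B T by (simp add: vec_cols_def mult.commute)
  note rr = mod_div_less[OF r]
  have "(kron B (1\<^sub>m n) *\<^sub>v vec_cols T) $ r = (\<Sum>q<m * n.
      B $$ (r div n, q div n) * 1\<^sub>m n $$ (r mod n, q mod n) * T $$ (q mod n, q div n))"
    using B T r by (simp add: scalar_prod_def kron_def vec_cols_def atLeast0LessThan mult.commute)
  also have "\<dots> = (\<Sum>j<m. \<Sum>i<n. B $$ (r div n, j) * 1\<^sub>m n $$ (r mod n, i) * T $$ (i, j))"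
    by (rule sum_mod_div[of "\<lambda>i j. B $$ (r div n, j) * 1\<^sub>m n $$ (r mod n, i) * T $$ (i, j)"])
  also have "\<dots> = (\<Sum>j<m. \<Sum>i<n. if i = r mod n then B $$ (r div n, j) * T $$ (i, j) else 0)"
    using rr by (intro sum.cong) auto
  also have "\<dots> = (\<Sum>j<m. T $$ (r mod n, j) * B $$ (r div n, j))"
    using rr by (simp add: mult.commute)
  also have "\<dots> = vec_cols (T * B\<^sup>T) $ r"
    using B T r rr by (simp add: scalar_prod_def vec_cols_def atLeast0LessThan mult.commute)
  finally show "(kron B (1\<^sub>m n) *\<^sub>v vec_cols T) $ r = vec_cols (T * B\<^sup>T) $ r" .
qed (use B T in \<open>simp add: kron_def vec_cols_def mult.commute\<close>)

section \<open>Toeplitz matrices as multiplication of truncated power series\<close>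

text \<open>Padding with zeros embeds vectors of every length in one commutative ring, whose laws
  then replace index manipulations with Toeplitz matrices.\<close>

definition fps_of_vec :: "real vec \<Rightarrow> real fps" where
  "fps_of_vec x = Abs_fps (\<lambda>i. if i < dim_vec x then x $ i else 0)"

lemma toeplitz_carrier: "x \<in> carrier_vec n \<Longrightarrow> toeplitz r x \<in> carrier_mat n r"
  by (auto simp: toeplitz_def)

text \<open>Column \<open>t\<close> of the Toeplitz matrix is \<open>x\<close> shifted down by
  \<open>t\<close>, so the product is the convolution of \<open>x\<close> and \<open>y\<close>, cut
  off after \<open>n\<close> entries.\<close>

lemma toeplitz_mult_vec:
  assumes x: "x \<in> carrier_vec n" and y: "y \<in> carrier_vec r"
  shows "toeplitz r x *\<^sub>v y = vec n (fps_nth (fps_of_vec x * fps_of_vec y))"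
proof (rule eq_vecI)
  fix s assume "s < dim_vec (vec n (fps_nth (fps_of_vec x * fps_of_vec y)))"
  hence s: "s < n" by simp
  have "(toeplitz r x *\<^sub>v y) $ s = (\<Sum>t\<in>{0..<r}. if t \<le> s then x $ (s - t) * y $ t else 0)"
    using s x y by (auto simp: toeplitz_def scalar_prod_def intro!: sum.cong)
  also have "\<dots> = (\<Sum>t\<in>{0..<r} \<inter> {0..s}. x $ (s - t) * y $ t)"
    by (auto simp: sum.inter_restrict intro!: sum.cong)
  \<comment> \<open>The added indices \<open>t \<ge> r\<close> contribute nothing, since the series
    of \<open>y\<close> is zero there.\<close>
  also have "\<dots> = (\<Sum>t\<in>{0..s}. fps_nth (fps_of_vec y) t * fps_nth (fps_of_vec x) (s - t))"
    using s x y by (intro sum.mono_neutral_cong_left) (auto simp: fps_of_vec_def)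
  also have "\<dots> = fps_nth (fps_of_vec x * fps_of_vec y) s"
    by (subst mult.commute) (simp add: fps_mult_nth)
  finally show "(toeplitz r x *\<^sub>v y) $ s = vec n (fps_nth (fps_of_vec x * fps_of_vec y)) $ s"
    using s by simp
qed (use x in \<open>simp add: toeplitz_def\<close>)

text \<open>Coefficient \<open>n\<close> of a product sees only coefficients up to \<open>n\<close>
  of its factors. This is what allows truncations to be inserted and removed inside a
  product.\<close>

lemma fps_nth_mult_cong:
  fixes f g h :: "real fps"
  assumes "\<And>i. i \<le> n \<Longrightarrow> fps_nth g i = fps_nth h i"
  shows "fps_nth (f * g) n = fps_nth (f * h) n"
  by (simp add: fps_mult_nth assms)

text \<open>Read as power series modulo \<open>z\<^sup>n\<close>, both sides are the product of \<open>b\<close>, \<open>d\<close> and \<open>m\<close>.\<close>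

lemma toeplitz_rotate:
  assumes b: "b \<in> carrier_vec n" and d: "d \<in> carrier_vec n" and m: "m \<in> carrier_vec l"
  shows "toeplitz n b *\<^sub>v (toeplitz l d *\<^sub>v m)
    = toeplitz n (resize_vec n m) *\<^sub>v (toeplitz n d *\<^sub>v b)"
proof (rule eq_vecI)
  let ?F = fps_of_vec
  have m': "resize_vec n m \<in> carrier_vec n" by (simp add: resize_vec_def)
  have v: "vec n f \<in> carrier_vec n" for f :: "nat \<Rightarrow> real" by simp
  fix s assume "s < dim_vec (toeplitz n (resize_vec n m) *\<^sub>v (toeplitz n d *\<^sub>v b))"
  hence s: "s < n" by (simp add: toeplitz_def resize_vec_def)
  have "(toeplitz n b *\<^sub>v (toeplitz l d *\<^sub>v m)) $ s = fps_nth (?F b * ?F (vec n (fps_nth (?F d * ?F m)))) s"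
    using s unfolding toeplitz_mult_vec[OF d m] toeplitz_mult_vec[OF b v] by simp
  also have "\<dots> = fps_nth (?F b * (?F d * ?F m)) s"
    using s by (intro fps_nth_mult_cong) (simp add: fps_of_vec_def)
  also have "\<dots> = fps_nth ((?F d * ?F b) * ?F m) s"
    by (simp add: ac_simps)
  \<comment> \<open>Whether \<open>resize_vec\<close> cuts \<open>m\<close> off or pads it with
    zeros, its series agrees with that of \<open>m\<close> below degree \<open>n\<close>; this
    treats both cases of the definition of \<open>m_breve\<close> at once.\<close>
  also have "\<dots> = fps_nth ((?F d * ?F b) * ?F (resize_vec n m)) s"
    using s m by (intro fps_nth_mult_cong) (simp add: fps_of_vec_def resize_vec_def)
  also have "\<dots> = fps_nth (?F (resize_vec n m) * (?F d * ?F b)) s"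
    by (simp add: mult.commute)
  also have "\<dots> = fps_nth (?F (resize_vec n m) * ?F (vec n (fps_nth (?F d * ?F b)))) s"
    using s by (intro fps_nth_mult_cong) (simp add: fps_of_vec_def)
  also have "\<dots> = (toeplitz n (resize_vec n m) *\<^sub>v (toeplitz n d *\<^sub>v b)) $ s"
    using s unfolding toeplitz_mult_vec[OF d b] toeplitz_mult_vec[OF m' v] by simp
  finally show "(toeplitz n b *\<^sub>v (toeplitz l d *\<^sub>v m)) $ s
    = (toeplitz n (resize_vec n m) *\<^sub>v (toeplitz n d *\<^sub>v b)) $ s" .
qed (use b in \<open>simp add: toeplitz_def resize_vec_def\<close>)

text \<open>
  Telescoping, \<open>\<beta>\<^bsup>max(x,y)\<^esup>\<close> is a nonnegative combination of the rank-one kernels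
  \<open>1(x \<le> k) 1(y \<le> k)\<close>.
\<close>

lemma psd_kernel:
  assumes "0 \<le> \<beta>" "\<beta> < 1" "0 \<le> c"
  shows "psd_mat (c \<cdot>\<^sub>m kernel l \<beta>)"
  unfolding psd_mat_def
proof
  fix v :: "real vec" assume "v \<in> carrier_vec (dim_row (c \<cdot>\<^sub>m kernel l \<beta>))"
  hence v: "v \<in> carrier_vec l" by (simp add: kernel_def)
  let ?h = "\<lambda>k. \<beta> ^ Suc k - \<beta> ^ Suc (Suc k)"
  have tele: "(\<Sum>k<n. ?h k) = \<beta> - \<beta> ^ Suc n" for n
    by (induction n) (auto simp: algebra_simps)
  have tele2: "(\<Sum>k\<in>{n..<l}. ?h k) = \<beta> ^ Suc n - \<beta> ^ Suc l" if "n \<le> l" for n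
    using that sum_diff_nat_ivl[of 0 n l ?h] tele[of n] tele[of l] by (simp add: atLeast0LessThan)
  \<comment> \<open>The telescoping sum stops at \<open>k = l - 1\<close>; the remainder
    \<open>\<beta> ^ Suc l\<close> is a multiple of the all-ones kernel, which is again of rank
    one.\<close>
  have ker: "\<beta> ^ max (x + 1) (y + 1) = \<beta> ^ Suc l + (\<Sum>k<l. if x \<le> k \<and> y \<le> k then ?h k else 0)"
    if "x < l" "y < l" for x y
  proof -
    have "(\<Sum>k<l. if x \<le> k \<and> y \<le> k then ?h k else 0) = (\<Sum>k\<in>{max x y..<l}. ?h k)"
      by (rule sum.mono_neutral_cong_right) auto
    also have "\<dots> = \<beta> ^ Suc (max x y) - \<beta> ^ Suc l" using that by (intro tele2) auto
    also have "Suc (max x y) = max (x + 1) (y + 1)" by simp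
    finally show ?thesis by simp
  qed
  \<comment> \<open>Each rank-one kernel contributes a multiple of the square of a partial sum of
    \<open>v\<close>.\<close>
  have sq: "(\<Sum>x<l. \<Sum>y<l. v $ x * v $ y * (if x \<le> k \<and> y \<le> k then a else 0))
      = a * (\<Sum>x<l. if x \<le> k then v $ x else 0)\<^sup>2" for k a
    unfolding power2_eq_square sum_product unfolding sum_distrib_left
    by (intro sum.cong) auto
  have "v \<bullet> (c \<cdot>\<^sub>m kernel l \<beta> *\<^sub>v v)
      = c * (\<Sum>x<l. \<Sum>y<l. v $ x * v $ y * \<beta> ^ max (x + 1) (y + 1))"
    using v by (auto simp: kernel_def scalar_prod_def atLeast0LessThan sum_distrib_left
        intro!: sum.cong)
  also have "(\<Sum>x<l. \<Sum>y<l. v $ x * v $ y * \<beta> ^ max (x + 1) (y + 1))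
     = (\<Sum>x<l. \<Sum>y<l. v $ x * v $ y * \<beta> ^ Suc l
         + (\<Sum>k<l. v $ x * v $ y * (if x \<le> k \<and> y \<le> k then ?h k else 0)))"
  proof (intro sum.cong refl)
    fix x y assume "x \<in> {..<l}" "y \<in> {..<l}"
    hence "x < l" "y < l" by auto
    from ker[OF this] show "v $ x * v $ y * \<beta> ^ max (x + 1) (y + 1) = v $ x * v $ y * \<beta> ^ Suc l
         + (\<Sum>k<l. v $ x * v $ y * (if x \<le> k \<and> y \<le> k then ?h k else 0))"
      by (simp only: distrib_left sum_distrib_left)
  qed
  also have "\<dots> = (\<Sum>x<l. \<Sum>y<l. v $ x * v $ y * \<beta> ^ Suc l)
     + (\<Sum>x<l. \<Sum>y<l. \<Sum>k<l. v $ x * v $ y * (if x \<le> k \<and> y \<le> k then ?h k else 0))"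
    by (simp only: sum.distrib)
  also have "(\<Sum>x<l. \<Sum>y<l. v $ x * v $ y * \<beta> ^ Suc l) = \<beta> ^ Suc l * (\<Sum>x<l. v $ x)\<^sup>2"
    by (simp add: power2_eq_square sum_product sum_distrib_left mult_ac)
  also have "(\<Sum>x<l. \<Sum>y<l. \<Sum>k<l. v $ x * v $ y * (if x \<le> k \<and> y \<le> k then ?h k else 0))
     = (\<Sum>x<l. \<Sum>k<l. \<Sum>y<l. v $ x * v $ y * (if x \<le> k \<and> y \<le> k then ?h k else 0))"
    by (intro sum.cong refl sum.swap)
  also have "\<dots> = (\<Sum>k<l. ?h k * (\<Sum>x<l. if x \<le> k then v $ x else 0)\<^sup>2)"
    unfolding sq[symmetric] by (rule sum.swap)
  finally have eq: "v \<bullet> (c \<cdot>\<^sub>m kernel l \<beta> *\<^sub>v v) = c * (\<beta> ^ Suc l * (\<Sum>x<l. v $ x)\<^sup>2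
     + (\<Sum>k<l. ?h k * (\<Sum>x<l. if x \<le> k then v $ x else 0)\<^sup>2))" .
  have "0 \<le> ?h k" for k using assms power_decreasing[of "Suc k" "Suc (Suc k)" \<beta>] by simp
  thus "0 \<le> v \<bullet> (c \<cdot>\<^sub>m kernel l \<beta> *\<^sub>v v)"
    unfolding eq using assms by (intro mult_nonneg_nonneg add_nonneg_nonneg sum_nonneg) auto
qed

section \<open>Block rows\<close>

lemma block_row_carrier:
  "(\<And>A. A \<in> set As \<Longrightarrow> A \<in> carrier_mat n l) \<Longrightarrow> block_row n As \<in> carrier_mat n (length As * l)"
proof (induction As)
  case (Cons A As)
  then have "A \<in> carrier_mat n l" "block_row n As \<in> carrier_mat n (length As * l)" by simp_all
  then show ?case by auto
qed auto

lemma block_row_zero: "block_row n (replicate k (0\<^sub>m n l)) = 0\<^sub>m n (k * l)"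
  by (induction k) (auto intro!: eq_matI)

lemma block_row_Cons_index:
  assumes "A \<in> carrier_mat n l" "block_row n As \<in> carrier_mat n q" "i < n" "j < l + q"
  shows "block_row n (A # As) $$ (i, j) = (if j < l then A $$ (i, j) else block_row n As $$ (i, j - l))"
  using assms by auto

lemma block_row_Cons_carrier:
  "A \<in> carrier_mat n l \<Longrightarrow> block_row n As \<in> carrier_mat n q \<Longrightarrow>
    block_row n (A # As) \<in> carrier_mat n (l + q)"
  by auto

lemma block_row_Cons_mult_vec:
  assumes A: "A \<in> carrier_mat n l" and B: "block_row n As \<in> carrier_mat n q"
    and x: "x \<in> carrier_vec l" and y: "y \<in> carrier_vec q"
  shows "block_row n (A # As) *\<^sub>v (x @\<^sub>v y) = A *\<^sub>v x + block_row n As *\<^sub>v y"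
proof -
  \<comment> \<open>The lower blocks of the underlying four-block matrix have no rows, so the second
    part of the product is the empty vector.\<close>
  have "block_row n (A # As) *\<^sub>v (x @\<^sub>v y)
      = (A *\<^sub>v x + block_row n As *\<^sub>v y) @\<^sub>v (0\<^sub>m 0 l *\<^sub>v x + 0\<^sub>m 0 q *\<^sub>v y)"
    using A B by (simp add: four_block_mat_mult_vec[OF A B zero_carrier_mat zero_carrier_mat x y])
  also have "\<dots> = A *\<^sub>v x + block_row n As *\<^sub>v y"
    by (rule eq_vecI) auto
  finally show ?thesis .
qed

lemma block_row_two_mult_vec:
  assumes A: "A \<in> carrier_mat n n" and B: "B \<in> carrier_mat n n"
    and x: "x \<in> carrier_vec n" and y: "y \<in> carrier_vec n"
  shows "block_row n [A, B] *\<^sub>v (x @\<^sub>v y) = A *\<^sub>v x + B *\<^sub>v y"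
proof -
  have "y @\<^sub>v 0\<^sub>v 0 = y" by (rule eq_vecI) auto
  hence "block_row n [B] *\<^sub>v y = B *\<^sub>v y + 0\<^sub>m n 0 *\<^sub>v 0\<^sub>v 0"
    using block_row_Cons_mult_vec[of B n n "[]" 0 y "0\<^sub>v 0"] B y by simp
  also have "\<dots> = B *\<^sub>v y" using B y by (auto intro!: eq_vecI)
  finally have 1: "block_row n [B] *\<^sub>v y = B *\<^sub>v y" .
  have 2: "block_row n [B] \<in> carrier_mat n n"
    using block_row_carrier[of "[B]" n n] B by (simp del: block_row.simps)
  show ?thesis using block_row_Cons_mult_vec[OF A 2 x y] by (simp only: 1)
qed

text \<open>Through this, \<open>Z_i\<close> and \<open>Z_j\<close> act only on the block of the
  posterior mean that belongs to the output node.\<close>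

lemma block_row_zero_mult_vec:
  assumes A: "A \<in> carrier_mat n l" and x: "x \<in> carrier_vec (l + k * l)"
  shows "block_row n (A # replicate k (0\<^sub>m n l)) *\<^sub>v x = A *\<^sub>v vec_first x l"
proof -
  have "block_row n (A # replicate k (0\<^sub>m n l)) *\<^sub>v (vec_first x l @\<^sub>v vec_last x (k * l))
      = A *\<^sub>v vec_first x l + 0\<^sub>m n (k * l) *\<^sub>v vec_last x (k * l)"
    using block_row_Cons_mult_vec[OF A, of "replicate k (0\<^sub>m n l)" "k * l" "vec_first x l" "vec_last x (k * l)"]
    by (simp add: block_row_zero del: block_row.simps)
  also have "\<dots> = A *\<^sub>v vec_first x l" using A by (auto intro!: eq_vecI simp: scalar_prod_def)
  finally show ?thesis using x by simp
qed

text \<open>Together with \<open>mult_block_row_zero\<close> this separates the constant part of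
  \<open>W_mat\<close> from the part that depends on \<theta>, which sits in the first
  block.\<close>

lemma block_row_add_first:
  assumes A: "A \<in> carrier_mat n l" and C: "C \<in> carrier_mat n l"
    and B: "block_row n As \<in> carrier_mat n (k * l)"
  shows "block_row n ((A + C) # As) = block_row n (A # As) + block_row n (C # replicate k (0\<^sub>m n l))"
proof -
  have Z: "block_row n (replicate k (0\<^sub>m n l)) \<in> carrier_mat n (k * l)" by (simp add: block_row_zero)
  have AC: "A + C \<in> carrier_mat n l" using A C by simp
  note c = block_row_Cons_carrier[OF A B] block_row_Cons_carrier[OF C Z] block_row_Cons_carrier[OF AC B]
  show ?thesis
  proof (rule eq_matI)
    fix i j
    assume "i < dim_row (block_row n (A # As) + block_row n (C # replicate k (0\<^sub>m n l)))"
      "j < dim_col (block_row n (A # As) + block_row n (C # replicate k (0\<^sub>m n l)))"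
    hence ij: "i < n" "j < l + k * l" using c by auto
    thus "block_row n ((A + C) # As) $$ (i, j)
        = (block_row n (A # As) + block_row n (C # replicate k (0\<^sub>m n l))) $$ (i, j)"
      using block_row_Cons_index[OF A B ij] block_row_Cons_index[OF C Z ij]
        block_row_Cons_index[OF AC B ij] c A C
      by (auto simp: block_row_zero simp del: block_row.simps)
  qed (use c in \<open>auto simp del: block_row.simps\<close>)
qed

lemma mult_block_row_zero:
  assumes T: "T \<in> carrier_mat n n" and C: "C \<in> carrier_mat n l"
  shows "T * block_row n (C # replicate k (0\<^sub>m n l)) = block_row n ((T * C) # replicate k (0\<^sub>m n l))"
proof -
  have Z: "block_row n (replicate k (0\<^sub>m n l)) \<in> carrier_mat n (k * l)" by (simp add: block_row_zero)
  have TC: "T * C \<in> carrier_mat n l" using T C by simp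
  note c = block_row_Cons_carrier[OF C Z] block_row_Cons_carrier[OF TC Z]
  show ?thesis
  proof (rule eq_matI)
    fix i j
    assume "i < dim_row (block_row n ((T * C) # replicate k (0\<^sub>m n l)))"
      "j < dim_col (block_row n ((T * C) # replicate k (0\<^sub>m n l)))"
    hence ij: "i < n" "j < l + k * l" using c by auto
    have "(T * block_row n (C # replicate k (0\<^sub>m n l))) $$ (i, j)
        = (\<Sum>r\<in>{0..<n}. T $$ (i, r) * block_row n (C # replicate k (0\<^sub>m n l)) $$ (r, j))"
      using T c ij by (simp add: scalar_prod_def del: block_row.simps)
    also have "\<dots> = (\<Sum>r\<in>{0..<n}. T $$ (i, r) * (if j < l then C $$ (r, j) else 0))"
      using ij by (intro sum.cong)
        (auto simp: block_row_Cons_index[OF C Z] block_row_zero simp del: block_row.simps)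
    also have "\<dots> = block_row n ((T * C) # replicate k (0\<^sub>m n l)) $$ (i, j)"
      using ij T C
      by (auto simp: block_row_Cons_index[OF TC Z] block_row_zero scalar_prod_def simp del: block_row.simps)
    finally show "(T * block_row n (C # replicate k (0\<^sub>m n l))) $$ (i, j)
        = block_row n ((T * C) # replicate k (0\<^sub>m n l)) $$ (i, j)" .
  qed (use c T in \<open>auto simp del: block_row.simps\<close>)
qed

section \<open>Quadratic forms and their minimization\<close>

lemma mat_trace_mult_outer_prod:
  assumes B: "B \<in> carrier_mat n n" and m: "m \<in> carrier_vec n"
  shows "mat_trace (B * outer_prod m) = m \<bullet> (B *\<^sub>v m)"
  using B m by (auto simp: mat_trace_def outer_prod_def scalar_prod_def sum_distrib_left
      atLeast0LessThan mult_ac intro!: sum.cong)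

text \<open>The diagonal entries of \<open>W * P * W\<^sup>T\<close> are the values of the form of
  \<open>P\<close> at the rows of \<open>W\<close>.\<close>

lemma mat_trace_psd:
  assumes W: "W \<in> carrier_mat N n" and P: "P \<in> carrier_mat n n" and psd: "psd_mat P"
  shows "0 \<le> mat_trace (W * P * W\<^sup>T)"
proof -
  have "mat_trace (W * P * W\<^sup>T) = mat_trace (W * (P * W\<^sup>T))"
    using W P by (simp add: assoc_mult_mat[of _ N n _ n _ N])
  also have "\<dots> = (\<Sum>r<N. row W r \<bullet> (P *\<^sub>v row W r))"
    using W P by (auto simp: mat_trace_def intro!: sum.cong arg_cong2[of _ _ _ _ scalar_prod] eq_vecI)
  also have "0 \<le> \<dots>" using W by (auto intro!: sum_nonneg psd_matD[OF psd P])
  finally show ?thesis by simp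
qed

lemma smult_mat_mult_vec:
  fixes A :: "real mat"
  shows "dim_vec x = dim_col A \<Longrightarrow> (c \<cdot>\<^sub>m A) *\<^sub>v x = c \<cdot>\<^sub>v (A *\<^sub>v x)"
  by (rule eq_vecI) (auto simp: scalar_prod_def sum_distrib_left mult.assoc)

text \<open>A matrix and its transpose have the same quadratic form, hence so does their
  average.\<close>

lemma scalar_prod_sym_part:
  assumes A: "A \<in> carrier_mat n n" and x: "x \<in> carrier_vec n"
  shows "x \<bullet> (sym_part A *\<^sub>v x) = x \<bullet> (A *\<^sub>v x)"
proof -
  have "x \<bullet> (A\<^sup>T *\<^sub>v x) = x \<bullet> (A *\<^sub>v x)"
    using transpose_vec_mult_scalar[OF A x x] comm_scalar_prod[of x n "A\<^sup>T *\<^sub>v x"] A x by simp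
  thus ?thesis using A x
    by (simp add: sym_part_def smult_mat_mult_vec add_mult_distrib_mat_vec[of _ n n]
        scalar_prod_add_distrib[of _ n])
qed

text \<open>Positive semidefiniteness of \<open>A\<close> is not assumed: it follows from the lower bound \<open>c\<close>.\<close>

lemma is_arg_min_quadratic_iff:
  fixes A :: "real mat" and b :: "real vec"
  assumes A: "A \<in> carrier_mat n n" and sym: "A\<^sup>T = A" and inv: "invertible_mat A"
    and b: "b \<in> carrier_vec n"
    and f: "\<And>x. x \<in> carrier_vec n \<Longrightarrow> f x = x \<bullet> (A *\<^sub>v x) - 2 * (b \<bullet> x)"
    and bdd: "\<And>x. x \<in> carrier_vec n \<Longrightarrow> c \<le> f x"
  shows "is_arg_min f (\<lambda>t. t \<in> carrier_vec n) x \<longleftrightarrow> x = minv A *\<^sub>v b"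
proof -
  note I = minv_inverse[OF A inv]
  have psd: "0 \<le> d \<bullet> (A *\<^sub>v d)" if d: "d \<in> carrier_vec n" for d
  proof (rule ccontr)
    let ?a = "d \<bullet> (A *\<^sub>v d)"
    assume "\<not> 0 \<le> ?a"
    hence a: "?a < 0" by simp
    \<comment> \<open>Averaging the values of \<open>f\<close> at the multiples \<open>t\<close> and
      \<open>- t\<close> of \<open>d\<close> cancels the linear term and gives
      \<open>c \<le> t\<^sup>2 * ?a\<close>. The summand 1 makes \<open>t\<close> at least 1, so
      that its square also exceeds \<open>c / ?a\<close>, a contradiction as \<open>?a\<close> is
      negative.\<close>
    define t where "t = \<bar>c / ?a\<bar> + 1"
    have Ad: "A *\<^sub>v d \<in> carrier_vec n" using A d by simp
    have ft: "f (s \<cdot>\<^sub>v d) = s\<^sup>2 * ?a - 2 * s * (b \<bullet> d)" for s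
      using f[of "s \<cdot>\<^sub>v d"] A d Ad b
      by (simp add: mult_mat_vec[OF A d] power2_eq_square)
    have "c \<le> t\<^sup>2 * ?a"
      using bdd[of "t \<cdot>\<^sub>v d"] bdd[of "(- t) \<cdot>\<^sub>v d"] ft[of t] ft[of "- t"] d by simp
    moreover have "c / ?a < t\<^sup>2"
    proof -
      have "c / ?a < t" unfolding t_def by linarith
      also have "t \<le> t\<^sup>2" unfolding t_def by (rule self_le_power) auto
      finally show ?thesis .
    qed
    ultimately show False using a by (simp add: field_simps)
  qed
  \<comment> \<open>The exact second-order expansion at \<open>x\<close>; symmetry of
    \<open>A\<close> merges the two cross terms into the gradient \<open>A *\<^sub>v x - b\<close>,
    up to the factor 2.\<close>
  have step: "f (x + d) = f x + d \<bullet> (A *\<^sub>v d) + 2 * (d \<bullet> (A *\<^sub>v x - b))"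
    if x: "x \<in> carrier_vec n" and d: "d \<in> carrier_vec n" for x d
  proof -
    have c: "A *\<^sub>v x \<in> carrier_vec n" "A *\<^sub>v d \<in> carrier_vec n" using A x d by auto
    have "x \<bullet> (A *\<^sub>v d) = d \<bullet> (A *\<^sub>v x)"
      using transpose_vec_mult_scalar[OF A d x] comm_scalar_prod[OF d c(1)] by (simp add: sym)
    moreover have "b \<bullet> d = d \<bullet> b" using b d by (rule comm_scalar_prod)
    ultimately show ?thesis using f[of "x + d"] f[OF x] x d b c
      by (simp add: mult_add_distrib_mat_vec[OF A x d] scalar_prod_add_distrib[of _ n]
          add_scalar_prod_distrib[of _ n] scalar_prod_minus_distrib[of _ n])
  qed
  show ?thesis
  proof
    assume "is_arg_min f (\<lambda>t. t \<in> carrier_vec n) x"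
    hence x: "x \<in> carrier_vec n" and min: "\<And>y. y \<in> carrier_vec n \<Longrightarrow> f x \<le> f y"
      by (auto simp: is_arg_min_def not_less)
    define r where "r = A *\<^sub>v x - b"
    have r: "r \<in> carrier_vec n" using A x b by (simp add: r_def)
    define a where "a = r \<bullet> (A *\<^sub>v r)"
    define \<rho> where "\<rho> = r \<bullet> r"
    have a: "0 \<le> a" using psd[OF r] by (simp add: a_def)
    have \<rho>: "0 \<le> \<rho>" by (simp add: \<rho>_def scalar_prod_self_nonneg)
    \<comment> \<open>A descent step along the residual \<open>r\<close>. The summand 1 keeps the
      denominator positive when \<open>a = 0\<close>; minimality then gives
      \<open>t * t \<le> t * \<rho>\<close>, while \<open>t * \<rho>\<close> is at most 0, so
      \<open>t\<close> and hence \<open>r\<close> vanish.\<close>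
    define t where "t = - \<rho> / (a + 1)"
    have ta: "t * (a + 1) = - \<rho>" using a by (simp add: t_def)
    have "f x \<le> f (x + t \<cdot>\<^sub>v r)" using x r by (intro min) auto
    also have "\<dots> = f x + t * t * a + 2 * (t * \<rho>)"
      using step[OF x, of "t \<cdot>\<^sub>v r"] A r
      by (simp add: mult_mat_vec[OF A r] a_def \<rho>_def r_def[symmetric])
    finally have "0 \<le> t * (t * (a + 1)) - t * t + 2 * (t * \<rho>)" by (simp add: algebra_simps)
    hence "0 \<le> t * \<rho> - t * t" unfolding ta by (simp add: mult.commute)
    moreover have "t * \<rho> \<le> 0" using a \<rho> by (simp add: t_def divide_nonpos_nonneg)
    ultimately have "t * t \<le> 0" by simp
    hence "t = 0" using mult_le_0_iff not_real_square_gt_zero by (metis linorder_not_less)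
    hence "\<rho> = 0" using ta by simp
    hence "r = 0\<^sub>v n" using r unfolding \<rho>_def by (rule scalar_prod_self_eq_0)
    hence "b + (A *\<^sub>v x - b) = b" using b by (simp add: r_def)
    hence "A *\<^sub>v x = b" using A b x by (auto simp: vec_eq_iff)
    hence "minv A *\<^sub>v b = (minv A * A) *\<^sub>v x" using assoc_mult_mat_vec[OF I(1) A x] by simp
    thus "x = minv A *\<^sub>v b" using I x by simp
  next
    assume x: "x = minv A *\<^sub>v b"
    have xc: "x \<in> carrier_vec n" using x I b by simp
    have "A *\<^sub>v x = b" using assoc_mult_mat_vec[OF A I(1) b] I b x by simp
    hence z: "A *\<^sub>v x - b = 0\<^sub>v n" using b by simp
    have "f x \<le> f y" if y: "y \<in> carrier_vec n" for y
    proof -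
      have d: "y - x \<in> carrier_vec n" using y xc by simp
      have "y = x + (y - x)" using y xc by (auto intro!: eq_vecI)
      hence "f y = f x + (y - x) \<bullet> (A *\<^sub>v (y - x))" using step[OF xc d] d by (simp add: z)
      thus ?thesis using psd[OF d] by simp
    qed
    thus "is_arg_min f (\<lambda>t. t \<in> carrier_vec n) x" using xc by (auto simp: is_arg_min_def not_less)
  qed
qed

lemma transpose_mult_vec_carrier: "A \<in> carrier_mat a b \<Longrightarrow> A\<^sup>T *\<^sub>v x \<in> carrier_vec b"
  by (intro carrier_vecI) simp

lemma kron_carrier:
  "A \<in> carrier_mat a b \<Longrightarrow> B \<in> carrier_mat c d \<Longrightarrow> kron A B \<in> carrier_mat (a * c) (b * d)"
  by (auto simp: kron_def)

lemma scalar_prod_transpose_mult: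
  fixes A B :: "real mat"
  assumes "A \<in> carrier_mat a b" "B \<in> carrier_mat a c" "x \<in> carrier_vec b" "y \<in> carrier_vec c"
  shows "x \<bullet> ((A\<^sup>T * B) *\<^sub>v y) = (A *\<^sub>v x) \<bullet> (B *\<^sub>v y)"
proof -
  have At: "A\<^sup>T \<in> carrier_mat b a" and By: "B *\<^sub>v y \<in> carrier_vec a" using assms by auto
  have "x \<bullet> ((A\<^sup>T * B) *\<^sub>v y) = x \<bullet> (A\<^sup>T *\<^sub>v (B *\<^sub>v y))"
    by (simp only: assoc_mult_mat_vec[OF At assms(2,4)])
  also have "\<dots> = (A\<^sup>T *\<^sub>v (B *\<^sub>v y)) \<bullet> x"
    by (rule comm_scalar_prod[OF assms(3)]) (use At By in simp)
  also have "\<dots> = (B *\<^sub>v y) \<bullet> (A *\<^sub>v x)" by (rule transpose_vec_mult_scalar[OF assms(1,3) By])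
  also have "\<dots> = (A *\<^sub>v x) \<bullet> (B *\<^sub>v y)"
    by (rule comm_scalar_prod[OF By]) (use assms in simp)
  finally show ?thesis .
qed

lemma resize_vec_carrier: "resize_vec n x \<in> carrier_vec n"
  by (simp add: resize_vec_def)

subsection \<open>Posterior moments and the expected log-likelihood\<close>

text \<open>The admissible ranges include a zero scaling and a zero kernel parameter, and either
  gives a zero block in \<open>K_mat\<close>. Since the posterior covariance is written with the
  inverse of \<open>K_mat\<close>, invertibility is assumed separately.\<close>

locale identification_setup =
  fixes S :: "'v setup_data" and \<eta> :: "'v hyperparams"
  assumes hyp: "\<And>k. k \<in> insert (outn S) (set (others S)) \<Longrightarrow> 0 \<le> lam \<eta> k \<and> 0 \<le> bet \<eta> k \<and> bet \<eta> k < 1"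
    and sigma2_pos: "sigma2 \<eta> > 0"
    and K_invertible: "invertible_mat (K_mat S \<eta>)"
begin

abbreviation "N \<equiv> nsamp S"
abbreviation "l \<equiv> irlen S"
abbreviation "p \<equiv> length (others S)"
abbreviation "n \<equiv> l + p * l"
abbreviation "P \<equiv> P_post S \<eta>"
abbreviation "m \<equiv> m_post S \<eta>"
abbreviation "Mh \<equiv> M_post S \<eta>"
abbreviation "Y \<equiv> Y_hat S \<eta>"
abbreviation "X \<equiv> X_mat S"

section \<open>Dimensions of the data matrices\<close>

lemma W_node_carrier: "W_node S k \<in> carrier_mat N l"
  and W_arrow_carrier: "W_arrow S k \<in> carrier_mat N l"
  and W_nodeN_carrier: "W_nodeN S k \<in> carrier_mat N N"
  and W_arrowN_carrier: "W_arrowN S k \<in> carrier_mat N N"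
  by (auto simp: W_node_def W_arrow_def W_nodeN_def W_arrowN_def toeplitz_def delay1_def delay2_def)

lemma g_ji_carrier: "b_ji S \<theta> \<in> carrier_vec N" "f_ji S \<theta> \<in> carrier_vec N" "g_ji S \<theta> \<in> carrier_vec (N + N)"
  by (auto simp: g_ji_def b_ji_def f_ji_def resize_vec_def)

lemma toeplitz_b_carrier: "toeplitz N (b_ji S \<theta>) \<in> carrier_mat N N"
  and toeplitz_f_carrier: "toeplitz N (f_ji S \<theta>) \<in> carrier_mat N N"
  using g_ji_carrier by (auto intro: toeplitz_carrier)

lemma others_carrier: "block_row N (map (W_node S) (others S)) \<in> carrier_mat N (p * l)"
  using block_row_carrier[of "map (W_node S) (others S)" N l] W_node_carrier by auto

lemma W_tilde_carrier: "W_tilde S \<theta> \<in> carrier_mat N l"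
  unfolding W_tilde_def using W_node_carrier W_arrow_carrier toeplitz_f_carrier toeplitz_b_carrier
  by (metis add_carrier_mat minus_carrier_mat mult_carrier_mat)

lemma W_mat_carrier: "W_mat S \<theta> \<in> carrier_mat N n"
  unfolding W_mat_def by (rule block_row_Cons_carrier[OF W_tilde_carrier others_carrier])

lemma X_mat_carrier: "X \<in> carrier_mat N n"
  unfolding X_mat_def by (rule block_row_Cons_carrier[OF W_node_carrier others_carrier])

lemma Z_carrier: "Z_i S \<in> carrier_mat N n" "Z_j S \<in> carrier_mat N n"
  unfolding Z_i_def Z_j_def
  by (rule block_row_Cons_carrier; simp add: W_arrow_carrier block_row_zero)+

lemma two_block_carrier:
  assumes "A \<in> carrier_mat N N" "B \<in> carrier_mat N N"
  shows "block_row N [A, B] \<in> carrier_mat N (N + N)"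
proof -
  have "block_row N [A, B] \<in> carrier_mat N (length [A, B] * N)"
    by (rule block_row_carrier) (use assms in auto)
  thus ?thesis by (simp add: mult_2 del: block_row.simps)
qed

lemma W_ji_carrier: "W_ji S \<in> carrier_mat N (N + N)"
  unfolding W_ji_def by (rule two_block_carrier) (auto simp: W_nodeN_carrier)

lemma Y_hat_carrier: "Y \<in> carrier_mat N (N + N)"
proof -
  have "toeplitz N (m_breve S \<eta>) \<in> carrier_mat N N"
    by (rule toeplitz_carrier) (simp add: m_breve_def resize_vec_carrier)
  moreover have "block_row N [W_arrowN S (inn S), - W_arrowN S (outn S)] \<in> carrier_mat N (N + N)"
    by (rule two_block_carrier) (auto simp: W_arrowN_carrier)
  ultimately show ?thesis unfolding Y_hat_def by (rule mult_carrier_mat)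
qed

section \<open>Prior and posterior covariance\<close>

lemma K_mat: "psd_mat (K_mat S \<eta>)" "K_mat S \<eta> \<in> carrier_mat n n"
proof -
  let ?As = "map (\<lambda>k. lam \<eta> k \<cdot>\<^sub>m kernel l (bet \<eta> k)) (outn S # others S)"
  have k: "kernel l \<beta> \<in> carrier_mat l l" for \<beta> by (simp add: kernel_def)
  have "\<And>A. A \<in> set ?As \<Longrightarrow> psd_mat A \<and> A \<in> carrier_mat l l"
    using hyp k by (auto intro!: psd_kernel)
  from psd_diag_block_mat[of ?As l, OF this] show "psd_mat (K_mat S \<eta>)" "K_mat S \<eta> \<in> carrier_mat n n"
    by (simp_all add: K_mat_def del: diag_block_mat.simps)
qed

text \<open>
  The regularized normal matrix must be shown invertible, since otherwise \<^const>\<open>minv\<close> would be an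
  unspecified matrix, even of unspecified dimensions.
\<close>

lemma P_post: "P \<in> carrier_mat n n" "psd_mat P"
proof -
  let ?W = "W_mat S (theta \<eta>)" and ?Ki = "minv (K_mat S \<eta>)" and ?c = "1 / sigma2 \<eta>"
  let ?A = "?c \<cdot>\<^sub>m (?W\<^sup>T * ?W) + ?Ki"
  note W = W_mat_carrier[of "theta \<eta>"]
  note Ki = minv_inverse[OF K_mat(2) K_invertible]
  have psdKi: "psd_mat ?Ki" by (rule psd_right_inverse[OF K_mat(2) Ki(1,2) K_mat(1)])
  have A: "?A \<in> carrier_mat n n" using W Ki by auto
  have split: "?A *\<^sub>v v = ?c \<cdot>\<^sub>v (?W\<^sup>T *\<^sub>v (?W *\<^sub>v v)) + ?Ki *\<^sub>v v" if v: "v \<in> carrier_vec n" for v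
    using W Ki v by (simp add: add_mult_distrib_mat_vec[of _ n n] smult_mat_mult_vec
        assoc_mult_mat_vec[of _ n N _ n])
  have quad: "v \<bullet> (?A *\<^sub>v v) = ?c * ((?W *\<^sub>v v) \<bullet> (?W *\<^sub>v v)) + v \<bullet> (?Ki *\<^sub>v v)"
    if v: "v \<in> carrier_vec n" for v
  proof -
    have Wv: "?W *\<^sub>v v \<in> carrier_vec N" using W v by simp
    have "v \<bullet> (?W\<^sup>T *\<^sub>v (?W *\<^sub>v v)) = (?W *\<^sub>v v) \<bullet> (?W *\<^sub>v v)"
      using transpose_vec_mult_scalar[OF W v Wv] comm_scalar_prod[of v n "?W\<^sup>T *\<^sub>v (?W *\<^sub>v v)"] W v
      by simp
    thus ?thesis using W Ki v Wv by (simp add: split[OF v] scalar_prod_add_distrib[of _ n])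
  qed
  have c: "?c > 0" using sigma2_pos by simp
  have psdA: "psd_mat ?A"
    unfolding psd_mat_def
  proof
    fix v :: "real vec" assume "v \<in> carrier_vec (dim_row ?A)"
    hence v: "v \<in> carrier_vec n" by (simp only: carrier_matD(1)[OF A])
    show "0 \<le> v \<bullet> (?A *\<^sub>v v)" unfolding quad[OF v]
      using psd_matD[OF psdKi Ki(1) v] c by (simp add: scalar_prod_self_nonneg)
  qed
  have "invertible_mat ?A"
  proof (rule invertible_mat_if_kernel_trivial[OF A])
    \<comment> \<open>At a kernel vector the quadratic form is zero. Both of its summands are
      nonnegative, so \<open>?W *\<^sub>v v\<close> vanishes and the equation reduces to
      \<open>?Ki *\<^sub>v v = 0\<^sub>v n\<close>; applying \<open>K_mat\<close> recovers
      \<open>v = 0\<^sub>v n\<close>.\<close>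
    fix v assume v: "v \<in> carrier_vec n" and 0: "?A *\<^sub>v v = 0\<^sub>v n"
    have "?c * ((?W *\<^sub>v v) \<bullet> (?W *\<^sub>v v)) + v \<bullet> (?Ki *\<^sub>v v) = 0"
      using quad[OF v] v by (simp add: 0)
    moreover have "0 \<le> ?c * ((?W *\<^sub>v v) \<bullet> (?W *\<^sub>v v))" "0 \<le> v \<bullet> (?Ki *\<^sub>v v)"
      using psd_matD[OF psdKi Ki(1) v] c by (simp_all add: scalar_prod_self_nonneg)
    ultimately have "?c * ((?W *\<^sub>v v) \<bullet> (?W *\<^sub>v v)) = 0" by linarith
    hence "(?W *\<^sub>v v) \<bullet> (?W *\<^sub>v v) = 0" using c by simp
    hence Wv: "?W *\<^sub>v v = 0\<^sub>v N" by (rule scalar_prod_self_eq_0) (use W v in simp)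
    have "?W\<^sup>T *\<^sub>v 0\<^sub>v N = 0\<^sub>v n" using W by (auto intro!: eq_vecI)
    moreover have "?c \<cdot>\<^sub>v 0\<^sub>v n = 0\<^sub>v n" by (auto intro!: eq_vecI)
    ultimately have "?Ki *\<^sub>v v = 0\<^sub>v n" using split[OF v] 0 Ki v by (simp add: Wv)
    moreover have "v = K_mat S \<eta> *\<^sub>v (?Ki *\<^sub>v v)"
      using assoc_mult_mat_vec[OF K_mat(2) Ki(1) v] Ki(2) v by simp
    ultimately show "v = 0\<^sub>v n" using K_mat(2) by (auto intro!: eq_vecI)
  qed
  note I = minv_inverse[OF A this]
  show "P \<in> carrier_mat n n" unfolding P_post_def by (rule I(1))
  show "psd_mat P" unfolding P_post_def by (rule psd_right_inverse[OF A I(1,2) psdA])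
qed

lemma m_post_carrier: "m \<in> carrier_vec n"
  using carrier_matD(1)[OF P_post(1)] by (intro carrier_vecI) (simp add: m_post_def)

lemma M_post_carrier: "Mh \<in> carrier_mat n n"
  using P_post(1) m_post_carrier by (auto simp: M_post_def outer_prod_def)

section \<open>Affine dependence of the regression matrix on \<theta>\<close>

abbreviation "E \<theta> \<equiv> toeplitz N (b_ji S \<theta>) * Z_i S + toeplitz N (f_ji S \<theta>) * Z_j S"

lemma W_mat_decomp: "W_mat S \<theta> = X + E \<theta>"
proof -
  let ?b = "toeplitz N (b_ji S \<theta>)" and ?f = "toeplitz N (f_ji S \<theta>)"
  let ?Wi = "W_arrow S (inn S)" and ?Wj = "W_arrow S (outn S)"
  let ?O = "map (W_node S) (others S)" and ?Z = "replicate p (0\<^sub>m N l)"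
  note c = W_node_carrier[of "outn S"] W_arrow_carrier[of "inn S"] W_arrow_carrier[of "outn S"]
    toeplitz_b_carrier[of \<theta>] toeplitz_f_carrier[of \<theta>]
  have c2: "?b * ?Wi \<in> carrier_mat N l" "?f * (- ?Wj) \<in> carrier_mat N l"
    "?b * ?Wi + ?f * (- ?Wj) \<in> carrier_mat N l" using c by auto
  have zc: "block_row N ?Z \<in> carrier_mat N (p * l)" by (simp add: block_row_zero)
  have mZ: "- ?Wj \<in> carrier_mat N l" using c by simp
  \<comment> \<open>The minus sign in \<open>W_tilde\<close> moves onto the arrow matrix of the
    output node, where \<open>Z_j\<close> carries it.\<close>
  have "W_tilde S \<theta> = W_node S (outn S) + (?b * ?Wi + ?f * (- ?Wj))"
    unfolding W_tilde_def using c c2 by (auto intro!: eq_matI simp: scalar_prod_def sum_negf)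
  hence "W_mat S \<theta> = X + block_row N ((?b * ?Wi + ?f * (- ?Wj)) # ?Z)"
    unfolding W_mat_def X_mat_def
    using block_row_add_first[OF c(1) c2(3) others_carrier] by (simp only:)
  also have "block_row N ((?b * ?Wi + ?f * (- ?Wj)) # ?Z) = E \<theta>"
    unfolding Z_i_def Z_j_def mult_block_row_zero[OF c(4,2)] mult_block_row_zero[OF c(5) mZ]
    by (rule block_row_add_first[OF c2(1,2) zc])
  finally show ?thesis .
qed

lemma E_carrier: "E \<theta> \<in> carrier_mat N n"
  using toeplitz_b_carrier toeplitz_f_carrier Z_carrier by (meson add_carrier_mat mult_carrier_mat)

text \<open>By \<open>toeplitz_rotate\<close> the unknown coefficients \<open>x\<close> and the
  posterior mean change places, so that \<open>x\<close> becomes the vector to which a known matrix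
  is applied.\<close>

lemma toeplitz_Z_mult:
  assumes x: "x \<in> carrier_vec N"
  shows "toeplitz N x *\<^sub>v (Z_i S *\<^sub>v m) = toeplitz N (m_breve S \<eta>) *\<^sub>v (W_arrowN S (inn S) *\<^sub>v x)"
    and "toeplitz N x *\<^sub>v (Z_j S *\<^sub>v m) = toeplitz N (m_breve S \<eta>) *\<^sub>v (- W_arrowN S (outn S) *\<^sub>v x)"
proof -
  have d: "delay2 S k \<in> carrier_vec N" for k by (simp add: delay2_def)
  have rot: "toeplitz N x *\<^sub>v (W_arrow S k *\<^sub>v vec_first m l)
      = toeplitz N (m_breve S \<eta>) *\<^sub>v (W_arrowN S k *\<^sub>v x)" for k
    unfolding W_arrow_def W_arrowN_def m_breve_def by (rule toeplitz_rotate[OF x d]) simp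
  show "toeplitz N x *\<^sub>v (Z_i S *\<^sub>v m) = toeplitz N (m_breve S \<eta>) *\<^sub>v (W_arrowN S (inn S) *\<^sub>v x)"
    unfolding Z_i_def block_row_zero_mult_vec[OF W_arrow_carrier m_post_carrier] by (rule rot)
  have neg: "- A *\<^sub>v v = (-1) \<cdot>\<^sub>v (A *\<^sub>v v)" if "dim_vec v = dim_col A" for A :: "real mat" and v
    using that by (auto intro!: eq_vecI)
  have tm: "toeplitz N (m_breve S \<eta>) \<in> carrier_mat N N"
    by (rule toeplitz_carrier) (simp add: m_breve_def resize_vec_carrier)
  have "- W_arrow S (outn S) \<in> carrier_mat N l" using W_arrow_carrier by simp
  from block_row_zero_mult_vec[OF this m_post_carrier]
  have "toeplitz N x *\<^sub>v (Z_j S *\<^sub>v m) = toeplitz N x *\<^sub>v (- W_arrow S (outn S) *\<^sub>v vec_first m l)"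
    unfolding Z_j_def by simp
  \<comment> \<open>The sign in \<open>Z_j\<close> is pulled out as a scalar so that
    \<open>rot\<close> applies, and put back afterwards.\<close>
  also have "\<dots> = (-1) \<cdot>\<^sub>v (toeplitz N x *\<^sub>v (W_arrow S (outn S) *\<^sub>v vec_first m l))"
    using W_arrow_carrier[of "outn S"] toeplitz_carrier[OF x, of N]
    by (subst neg) (auto intro!: mult_mat_vec[of _ N N])
  also have "\<dots> = toeplitz N (m_breve S \<eta>) *\<^sub>v (- W_arrowN S (outn S) *\<^sub>v x)"
    unfolding rot using W_arrowN_carrier[of "outn S"] x tm
    by (subst neg) (auto intro!: mult_mat_vec[of _ N N, symmetric])
  finally show "toeplitz N x *\<^sub>v (Z_j S *\<^sub>v m)
    = toeplitz N (m_breve S \<eta>) *\<^sub>v (- W_arrowN S (outn S) *\<^sub>v x)" .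
qed

text \<open>This is the origin of \<open>Y_hat\<close>: the part of the predicted output that
  depends on \<theta> is linear in \<open>g_ji\<close>, with \<open>Y_hat\<close> as its
  matrix.\<close>

lemma E_mult_m: "E \<theta> *\<^sub>v m = Y *\<^sub>v g_ji S \<theta>"
proof -
  let ?b = "toeplitz N (b_ji S \<theta>)" and ?f = "toeplitz N (f_ji S \<theta>)"
  let ?Wi = "W_arrowN S (inn S)" and ?Wj = "- W_arrowN S (outn S)" and ?T = "toeplitz N (m_breve S \<eta>)"
  have T: "?T \<in> carrier_mat N N"
    by (rule toeplitz_carrier) (simp add: m_breve_def resize_vec_carrier)
  have c: "?Wi \<in> carrier_mat N N" "?Wj \<in> carrier_mat N N" using W_arrowN_carrier by auto
  note g = g_ji_carrier[of \<theta>]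
  have "E \<theta> *\<^sub>v m = (?b * Z_i S) *\<^sub>v m + (?f * Z_j S) *\<^sub>v m"
    using toeplitz_b_carrier[of \<theta>] toeplitz_f_carrier[of \<theta>] Z_carrier m_post_carrier
    by (intro add_mult_distrib_mat_vec[of _ N n]) auto
  also have "\<dots> = ?b *\<^sub>v (Z_i S *\<^sub>v m) + ?f *\<^sub>v (Z_j S *\<^sub>v m)"
    using assoc_mult_mat_vec[OF toeplitz_b_carrier Z_carrier(1) m_post_carrier]
      assoc_mult_mat_vec[OF toeplitz_f_carrier Z_carrier(2) m_post_carrier] by simp
  also have "\<dots> = ?T *\<^sub>v (?Wi *\<^sub>v b_ji S \<theta>) + ?T *\<^sub>v (?Wj *\<^sub>v f_ji S \<theta>)"
    by (simp only: toeplitz_Z_mult[OF g(1)] toeplitz_Z_mult[OF g(2)])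
  also have "\<dots> = ?T *\<^sub>v (?Wi *\<^sub>v b_ji S \<theta> + ?Wj *\<^sub>v f_ji S \<theta>)"
    using c g T by (intro mult_add_distrib_mat_vec[symmetric, of _ N N]) auto
  also have "\<dots> = ?T *\<^sub>v (block_row N [?Wi, ?Wj] *\<^sub>v g_ji S \<theta>)"
    unfolding g_ji_def block_row_two_mult_vec[OF c g(1,2)] ..
  also have "\<dots> = Y *\<^sub>v g_ji S \<theta>"
    unfolding Y_hat_def by (rule assoc_mult_mat_vec[symmetric, OF T two_block_carrier[OF c] g(3)])
  finally show ?thesis .
qed

section \<open>The trace term as a quadratic polynomial in the coefficients\<close>

text \<open>The posterior expectation of the scalar product of the images of the latent vector under
  \<open>U\<close> and \<open>V\<close>. The two orders of the arguments are kept apart, matching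
  the two off-diagonal blocks of \<open>A_hat\<close> and the two halves of
  \<open>b_block\<close>.\<close>

definition trace_form :: "real mat \<Rightarrow> real mat \<Rightarrow> real" where
  "trace_form U V = mat_trace (U * Mh * V\<^sup>T)"

lemma trace_form_add:
  assumes "U \<in> carrier_mat N n" "U' \<in> carrier_mat N n" "V \<in> carrier_mat N n"
  shows "trace_form (U + U') V = trace_form U V + trace_form U' V"
    and "trace_form V (U + U') = trace_form V U + trace_form V U'"
proof -
  note M = M_post_carrier
  have c: "U * Mh \<in> carrier_mat N n" "U' * Mh \<in> carrier_mat N n" "V * Mh \<in> carrier_mat N n"
    using assms M by auto
  have t: "U\<^sup>T \<in> carrier_mat n N" "U'\<^sup>T \<in> carrier_mat n N" "V\<^sup>T \<in> carrier_mat n N" using assms by auto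
  show "trace_form (U + U') V = trace_form U V + trace_form U' V"
    unfolding trace_form_def add_mult_distrib_mat[OF assms(1,2) M] add_mult_distrib_mat[OF c(1,2) t(3)]
    by (rule mat_trace_add[of _ N]) (use c t in auto)
  show "trace_form V (U + U') = trace_form V U + trace_form V U'"
    unfolding trace_form_def transpose_add[OF assms(1,2)] mult_add_distrib_mat[OF c(3) t(1,2)]
    by (rule mat_trace_add[of _ N]) (use c t in auto)
qed

lemma trace_form_self:
  assumes W: "W \<in> carrier_mat N n"
  shows "mat_trace (W\<^sup>T * W * Mh) = trace_form W W"
proof -
  note M = M_post_carrier
  have WM: "W * Mh \<in> carrier_mat N n" and Wt: "W\<^sup>T \<in> carrier_mat n N" using W M by auto
  show ?thesis
    unfolding trace_form_def assoc_mult_mat[OF Wt W M] by (rule mat_trace_comm[OF Wt WM])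
qed

lemma A_block_carrier:
  assumes "Z \<in> carrier_mat N n" "Z' \<in> carrier_mat N n"
  shows "A_block S \<eta> Z Z' \<in> carrier_mat N N"
proof -
  have "kron (Z * Mh * Z'\<^sup>T) (1\<^sub>m N) \<in> carrier_mat (N * N) (N * N)"
    by (rule kron_carrier) (use assms in auto)
  thus ?thesis using D1_carrier[of N] by (auto simp: A_block_def)
qed

lemma b_block_carrier: "b_block S \<eta> Z \<in> carrier_vec N"
  using D1_carrier[of N] by (intro carrier_vecI) (auto simp: b_block_def)

text \<open>\<open>D1\<close> turns a coefficient vector into its vectorized Toeplitz matrix, the
  Kronecker factor becomes a matrix product, and the resulting Frobenius product is a trace that is
  rotated cyclically.\<close>

lemma A_block_form:
  assumes Z: "Z \<in> carrier_mat N n" and Z': "Z' \<in> carrier_mat N n"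
    and x: "x \<in> carrier_vec N" and y: "y \<in> carrier_vec N"
  shows "x \<bullet> (A_block S \<eta> Z Z' *\<^sub>v y) = trace_form (toeplitz N x * Z) (toeplitz N y * Z')"
proof -
  let ?B = "Z * Mh * Z'\<^sup>T" and ?Tx = "toeplitz N x" and ?Ty = "toeplitz N y" and ?D = "D1 N"
  let ?K = "kron ?B (1\<^sub>m N)"
  note M = M_post_carrier and D = D1_carrier[of N]
  have ZM: "Z * Mh \<in> carrier_mat N n" and Z't: "Z'\<^sup>T \<in> carrier_mat n N" using Z M Z' by auto
  have B: "?B \<in> carrier_mat N N" using ZM Z't by simp
  have T: "?Tx \<in> carrier_mat N N" "?Ty \<in> carrier_mat N N" using x y by (auto intro: toeplitz_carrier)
  have Tt: "?Ty\<^sup>T \<in> carrier_mat N N" "?Tx\<^sup>T \<in> carrier_mat N N" "?B\<^sup>T \<in> carrier_mat N N" using T B by auto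
  have K: "?K \<in> carrier_mat (N * N) (N * N)" by (rule kron_carrier[OF B]) simp
  have Dt: "?D\<^sup>T \<in> carrier_mat N (N * N)" using D by simp
  have DK: "?D\<^sup>T * ?K \<in> carrier_mat N (N * N)" using Dt K by simp
  have v: "?D *\<^sub>v y \<in> carrier_vec (N * N)" using D y by simp
  have KD: "?K *\<^sub>v (?D *\<^sub>v y) \<in> carrier_vec (N * N)" using K v by simp
  have "x \<bullet> (A_block S \<eta> Z Z' *\<^sub>v y) = x \<bullet> (?D\<^sup>T *\<^sub>v (?K *\<^sub>v (?D *\<^sub>v y)))"
    unfolding A_block_def assoc_mult_mat_vec[OF DK D y] assoc_mult_mat_vec[OF Dt K v] ..
  also have "\<dots> = (?D\<^sup>T *\<^sub>v (?K *\<^sub>v (?D *\<^sub>v y))) \<bullet> x"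
    by (rule comm_scalar_prod[OF x]) (use Dt KD in simp)
  also have "\<dots> = (?K *\<^sub>v (?D *\<^sub>v y)) \<bullet> (?D *\<^sub>v x)"
    by (rule transpose_vec_mult_scalar[OF D x KD])
  also have "\<dots> = vec_cols (?Ty * ?B\<^sup>T) \<bullet> vec_cols ?Tx"
    unfolding D1_mult_vec[OF x] D1_mult_vec[OF y] kron_one_mult_vec_cols[OF B T(2)] ..
  also have "\<dots> = mat_trace ((?Ty * ?B\<^sup>T)\<^sup>T * ?Tx)"
    by (rule scalar_prod_vec_cols) (use T Tt in auto)
  also have "(?Ty * ?B\<^sup>T)\<^sup>T = ?B * ?Ty\<^sup>T"
    by (simp add: transpose_mult[OF T(2) Tt(3)])
  also have "mat_trace (?B * ?Ty\<^sup>T * ?Tx) = mat_trace (?Tx * (?B * ?Ty\<^sup>T))"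
    by (rule mat_trace_comm[of _ N N]) (use B T Tt in auto)
  also have "?Tx * (?B * ?Ty\<^sup>T) = ?Tx * (Z * Mh * (Z'\<^sup>T * ?Ty\<^sup>T))"
    unfolding assoc_mult_mat[OF ZM Z't Tt(1)] ..
  also have "\<dots> = ?Tx * (Z * Mh) * (Z'\<^sup>T * ?Ty\<^sup>T)"
    by (rule assoc_mult_mat[OF T(1) ZM, symmetric]) (use Z't Tt in auto)
  also have "?Tx * (Z * Mh) = ?Tx * Z * Mh"
    by (rule assoc_mult_mat[OF T(1) Z M, symmetric])
  also have "Z'\<^sup>T * ?Ty\<^sup>T = (?Ty * Z')\<^sup>T"
    by (rule transpose_mult[OF T(2) Z', symmetric])
  finally show ?thesis by (simp add: trace_form_def)
qed

text \<open>The two halves of \<open>b_block\<close> give the two cross terms between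
  \<open>X_mat\<close> and the part depending on \<theta>. The Frobenius product transposes its
  first factor, which undoes the transpose on \<open>Mh\<close>; in the first half the Toeplitz
  matrix must appear transposed, hence \<open>D2\<close>.\<close>

lemma b_block_form:
  assumes Z: "Z \<in> carrier_mat N n" and x: "x \<in> carrier_vec N"
  shows "2 * (b_block S \<eta> Z \<bullet> x)
    = - trace_form X (toeplitz N x * Z) - trace_form (toeplitz N x * Z) X"
proof -
  let ?T = "toeplitz N x"
  note M = M_post_carrier and X = X_mat_carrier
  have T: "?T \<in> carrier_mat N N" using x by (rule toeplitz_carrier)
  have t: "Mh\<^sup>T \<in> carrier_mat n n" "X\<^sup>T \<in> carrier_mat n N" "Z\<^sup>T \<in> carrier_mat n N" "?T\<^sup>T \<in> carrier_mat N N"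
    using M X Z T by auto
  have tr: "(U * Mh\<^sup>T * V\<^sup>T)\<^sup>T = V * Mh * U\<^sup>T" if U: "U \<in> carrier_mat N n" and V: "V \<in> carrier_mat N n" for U V
  proof -
    have "(U * Mh\<^sup>T * V\<^sup>T)\<^sup>T = V * (U * Mh\<^sup>T)\<^sup>T"
      using U V t by (subst transpose_mult[of _ N n _ N]) auto
    also have "(U * Mh\<^sup>T)\<^sup>T = Mh * U\<^sup>T"
      using U t by (subst transpose_mult[of _ N n _ n]) auto
    also have "V * (Mh * U\<^sup>T) = V * Mh * U\<^sup>T"
      by (rule assoc_mult_mat[symmetric, OF V M]) (use U in auto)
    finally show ?thesis .
  qed
  have P: "Z * Mh\<^sup>T * X\<^sup>T \<in> carrier_mat N N" "X * Mh\<^sup>T * Z\<^sup>T \<in> carrier_mat N N"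
    using t Z X by auto
  have XM: "X * Mh \<in> carrier_mat N n" "Z * Mh \<in> carrier_mat N n" using X M Z by auto
  have "((D2 N)\<^sup>T *\<^sub>v vec_cols (Z * Mh\<^sup>T * X\<^sup>T)) \<bullet> x = vec_cols (Z * Mh\<^sup>T * X\<^sup>T) \<bullet> vec_cols (?T\<^sup>T)"
    using transpose_vec_mult_scalar[OF D2_carrier x vec_cols_carrier[OF P(1)]]
    by (simp only: D2_mult_vec[OF x])
  also have "\<dots> = mat_trace (X * Mh * Z\<^sup>T * ?T\<^sup>T)"
    by (simp only: scalar_prod_vec_cols[OF P(1) t(4)] tr[OF Z X])
  also have "X * Mh * Z\<^sup>T * ?T\<^sup>T = X * Mh * (?T * Z)\<^sup>T"
    unfolding transpose_mult[OF T Z] by (rule assoc_mult_mat[OF XM(1) t(3,4)])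
  finally have 1: "((D2 N)\<^sup>T *\<^sub>v vec_cols (Z * Mh\<^sup>T * X\<^sup>T)) \<bullet> x = trace_form X (?T * Z)"
    by (simp add: trace_form_def)
  have "((D1 N)\<^sup>T *\<^sub>v vec_cols (X * Mh\<^sup>T * Z\<^sup>T)) \<bullet> x = vec_cols (X * Mh\<^sup>T * Z\<^sup>T) \<bullet> vec_cols ?T"
    using transpose_vec_mult_scalar[OF D1_carrier x vec_cols_carrier[OF P(2)]]
    by (simp only: D1_mult_vec[OF x])
  also have "\<dots> = mat_trace (Z * Mh * X\<^sup>T * ?T)"
    by (simp only: scalar_prod_vec_cols[OF P(2) T] tr[OF X Z])
  also have "\<dots> = mat_trace (?T * (Z * Mh * X\<^sup>T))"
    by (rule mat_trace_comm[of _ N N]) (use XM t T in auto)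
  also have "?T * (Z * Mh * X\<^sup>T) = ?T * (Z * Mh) * X\<^sup>T"
    by (rule assoc_mult_mat[OF T XM(2) t(2), symmetric])
  also have "?T * (Z * Mh) = ?T * Z * Mh"
    by (rule assoc_mult_mat[OF T Z M, symmetric])
  finally have 2: "((D1 N)\<^sup>T *\<^sub>v vec_cols (X * Mh\<^sup>T * Z\<^sup>T)) \<bullet> x = trace_form (?T * Z) X"
    by (simp add: trace_form_def)
  have c: "(D2 N)\<^sup>T *\<^sub>v vec_cols (Z * Mh\<^sup>T * X\<^sup>T) \<in> carrier_vec N"
    "(D1 N)\<^sup>T *\<^sub>v vec_cols (X * Mh\<^sup>T * Z\<^sup>T) \<in> carrier_vec N"
    by (rule transpose_mult_vec_carrier[OF D2_carrier] transpose_mult_vec_carrier[OF D1_carrier])+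
  show ?thesis unfolding b_block_def
    using c x by (simp add: minus_scalar_prod_distrib[of _ N] 1 2 del: One_nat_def)
qed

abbreviation "A_quad \<equiv> four_block_mat
  (A_block S \<eta> (Z_i S) (Z_i S)) (A_block S \<eta> (Z_i S) (Z_j S))
  (A_block S \<eta> (Z_j S) (Z_i S)) (A_block S \<eta> (Z_j S) (Z_j S))"

abbreviation "b_lin \<equiv> b_block S \<eta> (Z_i S) @\<^sub>v b_block S \<eta> (Z_j S)"

lemma A_quad_carrier: "A_quad \<in> carrier_mat (N + N) (N + N)"
  using A_block_carrier Z_carrier by simp

lemma b_lin_carrier: "b_lin \<in> carrier_vec (N + N)"
  using b_block_carrier by simp

text \<open>With \<open>W_mat\<close> a sum of three matrices, the trace form expands into nine
  terms: one constant, four collected by \<open>A_quad\<close> and four by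
  \<open>b_lin\<close>.\<close>

lemma mat_trace_W_mat:
  "mat_trace ((W_mat S \<theta>)\<^sup>T * W_mat S \<theta> * Mh)
    = trace_form X X + g_ji S \<theta> \<bullet> (A_quad *\<^sub>v g_ji S \<theta>) - 2 * (b_lin \<bullet> g_ji S \<theta>)"
proof -
  let ?U = "toeplitz N (b_ji S \<theta>) * Z_i S" and ?V = "toeplitz N (f_ji S \<theta>) * Z_j S"
  let ?b = "b_ji S \<theta>" and ?f = "f_ji S \<theta>"
  note g = g_ji_carrier[of \<theta>] and X = X_mat_carrier and A = A_block_carrier
  note Z = Z_carrier and b = b_block_carrier
  have UV: "?U \<in> carrier_mat N n" "?V \<in> carrier_mat N n"
    by (rule mult_carrier_mat[OF toeplitz_b_carrier Z(1)] mult_carrier_mat[OF toeplitz_f_carrier Z(2)])+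
  have UVc: "?U + ?V \<in> carrier_mat N n" and XUV: "X + (?U + ?V) \<in> carrier_mat N n" using UV X by auto
  have Av: "A_block S \<eta> Z Z' *\<^sub>v x \<in> carrier_vec N"
    if "Z \<in> carrier_mat N n" "Z' \<in> carrier_mat N n" "x \<in> carrier_vec N" for Z Z' x
    using A[OF that(1,2)] that(3) by simp
  have "g_ji S \<theta> \<bullet> (A_quad *\<^sub>v g_ji S \<theta>)
      = trace_form ?U ?U + trace_form ?U ?V + trace_form ?V ?U + trace_form ?V ?V"
    unfolding g_ji_def
      four_block_mat_mult_vec[OF A[OF Z(1,1)] A[OF Z(1,2)] A[OF Z(2,1)] A[OF Z(2,2)] g(1,2)]
    using g Av Z by (simp add: scalar_prod_append[of _ N _ N] scalar_prod_add_distrib[of _ N]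
        A_block_form)
  moreover have "2 * (b_lin \<bullet> g_ji S \<theta>)
      = - trace_form X ?U - trace_form ?U X - trace_form X ?V - trace_form ?V X"
    unfolding g_ji_def scalar_prod_append[OF b b g(1,2)] distrib_left
      b_block_form[OF Z(1) g(1)] b_block_form[OF Z(2) g(2)] by simp
  moreover have "mat_trace ((W_mat S \<theta>)\<^sup>T * W_mat S \<theta> * Mh)
      = trace_form (X + (?U + ?V)) (X + (?U + ?V))"
    using trace_form_self[OF W_mat_carrier] by (simp only: W_mat_decomp)
  ultimately show ?thesis
    unfolding trace_form_add(1)[OF X UVc XUV] trace_form_add(2)[OF X UVc X] trace_form_add(2)[OF X UVc UVc]
      trace_form_add(1)[OF UV X] trace_form_add(2)[OF UV X] trace_form_add(1)[OF UV UVc]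
      trace_form_add(2)[OF UV UV(1)] trace_form_add(2)[OF UV UV(2)]
    by simp
qed

section \<open>Comparison of the expected log-likelihood with the quadratic cost\<close>

definition bracket :: "real vec \<Rightarrow> real" where
  "bracket \<theta> = w_out S \<bullet> w_out S
      - 2 * (w_out S \<bullet> (W_ji S *\<^sub>v g_ji S \<theta>))
      + g_ji S \<theta> \<bullet> (((W_ji S)\<^sup>T * W_ji S) *\<^sub>v g_ji S \<theta>)
      - 2 * (w_out S \<bullet> (W_mat S \<theta> *\<^sub>v m))
      + 2 * (g_ji S \<theta> \<bullet> (((W_ji S)\<^sup>T * W_mat S \<theta>) *\<^sub>v m))
      + mat_trace ((W_mat S \<theta>)\<^sup>T * W_mat S \<theta> * Mh)"

lemma w_out_carrier: "w_out S \<in> carrier_vec N"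
  by (simp add: w_out_def)

lemma A_hat_carrier: "A_hat S \<eta> \<in> carrier_mat (N + N) (N + N)"
  unfolding A_hat_def using A_quad_carrier W_ji_carrier Y_hat_carrier by auto

lemma b_hat_carrier: "b_hat S \<eta> \<in> carrier_vec (N + N)"
  unfolding b_hat_def
  by (intro add_carrier_vec minus_carrier_vec b_lin_carrier
      transpose_mult_vec_carrier[OF W_ji_carrier] transpose_mult_vec_carrier[OF Y_hat_carrier])

text \<open>Writing \<open>W_mat S \<theta> *\<^sub>v m\<close> as
  \<open>X *\<^sub>v m + Y *\<^sub>v g_ji S \<theta>\<close> explains the remaining summands. The
  product with \<open>w_out\<close> gives the \<open>Y_hat\<close> term of \<open>b_hat\<close>; the
  product with \<open>W_ji\<close> gives the \<open>Y_hat\<close> term of \<open>A_hat\<close> and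
  the \<open>X_mat\<close> term of \<open>b_hat\<close>.\<close>

lemma bracket_eq_quad_cost:
  "bracket \<theta> = (w_out S \<bullet> w_out S - 2 * (w_out S \<bullet> (X *\<^sub>v m)) + trace_form X X) + quad_cost S \<eta> \<theta>"
proof -
  let ?g = "g_ji S \<theta>" and ?w = "w_out S" and ?V = "W_ji S"
  note g = g_ji_carrier(3)[of \<theta>] and w = w_out_carrier and V = W_ji_carrier and Y = Y_hat_carrier
    and m = m_post_carrier and X = X_mat_carrier and A = A_quad_carrier and W = W_mat_carrier[of \<theta>]
  have Xm: "X *\<^sub>v m \<in> carrier_vec N" and Yg: "Y *\<^sub>v ?g \<in> carrier_vec N"
    and Vg: "?V *\<^sub>v ?g \<in> carrier_vec N" using X Y V m g by auto
  have Wm: "W_mat S \<theta> *\<^sub>v m = X *\<^sub>v m + Y *\<^sub>v ?g"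
    unfolding W_mat_decomp add_mult_distrib_mat_vec[OF X E_carrier m] E_mult_m ..
  have c: "A_quad \<in> carrier_mat (N + N) (N + N)" "?V\<^sup>T * ?V \<in> carrier_mat (N + N) (N + N)"
    "?V\<^sup>T * Y \<in> carrier_mat (N + N) (N + N)" "2 \<cdot>\<^sub>m (?V\<^sup>T * Y) \<in> carrier_mat (N + N) (N + N)"
    "A_quad + ?V\<^sup>T * ?V \<in> carrier_mat (N + N) (N + N)"
    using A V Y by auto
  have cv: "A_quad *\<^sub>v ?g \<in> carrier_vec (N + N)" "(?V\<^sup>T * ?V) *\<^sub>v ?g \<in> carrier_vec (N + N)"
    "(?V\<^sup>T * Y) *\<^sub>v ?g \<in> carrier_vec (N + N)"
    using mult_mat_vec_carrier[OF c(1) g] mult_mat_vec_carrier[OF c(2) g] mult_mat_vec_carrier[OF c(3) g]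
    by auto
  have A_g: "?g \<bullet> (A_hat S \<eta> *\<^sub>v ?g) = ?g \<bullet> (A_quad *\<^sub>v ?g) + (?V *\<^sub>v ?g) \<bullet> (?V *\<^sub>v ?g)
      + 2 * ((?V *\<^sub>v ?g) \<bullet> (Y *\<^sub>v ?g))"
  proof -
    have "(2 \<cdot>\<^sub>m (?V\<^sup>T * Y)) *\<^sub>v ?g = 2 \<cdot>\<^sub>v ((?V\<^sup>T * Y) *\<^sub>v ?g)"
      by (rule smult_mat_mult_vec) (use g c(3) in auto)
    hence "A_hat S \<eta> *\<^sub>v ?g = A_quad *\<^sub>v ?g + (?V\<^sup>T * ?V) *\<^sub>v ?g + 2 \<cdot>\<^sub>v ((?V\<^sup>T * Y) *\<^sub>v ?g)"
      unfolding A_hat_def add_mult_distrib_mat_vec[OF c(5,4) g] add_mult_distrib_mat_vec[OF c(1,2) g]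
      by simp
    thus ?thesis using g cv scalar_prod_transpose_mult[OF V V g g] scalar_prod_transpose_mult[OF V Y g g]
      by (simp add: scalar_prod_add_distrib[of _ "N + N"])
  qed
  have t: "?V\<^sup>T *\<^sub>v ?w \<in> carrier_vec (N + N)" "Y\<^sup>T *\<^sub>v ?w \<in> carrier_vec (N + N)"
    "?V\<^sup>T *\<^sub>v (X *\<^sub>v m) \<in> carrier_vec (N + N)"
    using V Y by (simp_all only: transpose_mult_vec_carrier)
  have b_g: "b_hat S \<eta> \<bullet> ?g = b_lin \<bullet> ?g + ?w \<bullet> (?V *\<^sub>v ?g) + ?w \<bullet> (Y *\<^sub>v ?g) - (X *\<^sub>v m) \<bullet> (?V *\<^sub>v ?g)"
    unfolding b_hat_def using t g b_lin_carrier
      transpose_vec_mult_scalar[OF V g w] transpose_vec_mult_scalar[OF Y g w]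
      transpose_vec_mult_scalar[OF V g Xm]
    by (simp add: add_scalar_prod_distrib[of _ "N + N"] minus_scalar_prod_distrib[of _ "N + N"])
  have comm: "(X *\<^sub>v m) \<bullet> (?V *\<^sub>v ?g) = (?V *\<^sub>v ?g) \<bullet> (X *\<^sub>v m)" by (rule comm_scalar_prod[OF Xm Vg])
  show ?thesis
    unfolding bracket_def quad_cost_def A_g b_g mat_trace_W_mat
      scalar_prod_transpose_mult[OF V V g g] scalar_prod_transpose_mult[OF V W g m] Wm
      scalar_prod_add_distrib[OF w Xm Yg] scalar_prod_add_distrib[OF Vg Xm Yg] comm
    by simp
qed

text \<open>The outer product inside \<open>M_post\<close> supplies the term
  \<open>?u \<bullet> ?u\<close> that completes the squared residual; the covariance leaves a
  nonnegative trace.\<close>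

lemma bracket_nonneg: "0 \<le> bracket \<theta>"
proof -
  let ?W = "W_mat S \<theta>" and ?w = "w_out S" and ?a = "W_ji S *\<^sub>v g_ji S \<theta>"
  let ?u = "?W *\<^sub>v m"
  note W = W_mat_carrier[of \<theta>] and m = m_post_carrier and w = w_out_carrier
    and V = W_ji_carrier and g = g_ji_carrier(3)[of \<theta>] and P = P_post
  have a: "?a \<in> carrier_vec N" and u: "?u \<in> carrier_vec N" using W m V g by auto
  have Wt: "?W\<^sup>T \<in> carrier_mat n N" and WtW: "?W\<^sup>T * ?W \<in> carrier_mat n n" and WP: "?W * P \<in> carrier_mat N n"
    using W P by auto
  have o: "outer_prod m \<in> carrier_mat n n" using m by (simp add: outer_prod_def)
  have "mat_trace (?W\<^sup>T * ?W * Mh) = mat_trace (?W\<^sup>T * ?W * P) + mat_trace (?W\<^sup>T * ?W * outer_prod m)"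
    unfolding M_post_def mult_add_distrib_mat[OF WtW P(1) o]
    by (rule mat_trace_add[of _ n]) (use WtW P o in auto)
  also have "mat_trace (?W\<^sup>T * ?W * P) = mat_trace (?W * P * ?W\<^sup>T)"
    unfolding assoc_mult_mat[OF Wt W P(1)] by (rule mat_trace_comm[OF Wt WP])
  also have "mat_trace (?W\<^sup>T * ?W * outer_prod m) = ?u \<bullet> ?u"
    unfolding mat_trace_mult_outer_prod[OF WtW m] by (rule scalar_prod_transpose_mult[OF W W m m])
  finally have tr: "mat_trace (?W\<^sup>T * ?W * Mh) = mat_trace (?W * P * ?W\<^sup>T) + ?u \<bullet> ?u" .
  have "(?w - ?a - ?u) \<bullet> (?w - ?a - ?u) = ?w \<bullet> ?w - 2 * (?w \<bullet> ?a) + ?a \<bullet> ?a - 2 * (?w \<bullet> ?u)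
      + 2 * (?a \<bullet> ?u) + ?u \<bullet> ?u"
    using w a u comm_scalar_prod[OF w a] comm_scalar_prod[OF w u] comm_scalar_prod[OF a u]
    by (simp add: minus_scalar_prod_distrib[of _ N] scalar_prod_minus_distrib[of _ N])
  hence "bracket \<theta> = (?w - ?a - ?u) \<bullet> (?w - ?a - ?u) + mat_trace (?W * P * ?W\<^sup>T)"
    unfolding bracket_def tr scalar_prod_transpose_mult[OF V V g g] scalar_prod_transpose_mult[OF V W g m]
    by simp
  thus ?thesis using mat_trace_psd[OF W P] scalar_prod_self_nonneg[of "?w - ?a - ?u"] by linarith
qed

lemma Q0_bracket: "Q0 S \<eta> s \<theta> = - real N * ln s - 1 / s * bracket \<theta>"
  by (simp add: Q0_def bracket_def)

text \<open>For fixed positive \<open>s\<close>, \<open>Q0\<close> is a strictly decreasing affine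
  function of the quadratic cost.\<close>

lemma is_arg_max_Q0_iff:
  assumes s: "s > 0"
  shows "is_arg_max (Q0 S \<eta> s) Q \<theta> \<longleftrightarrow> is_arg_min (quad_cost S \<eta>) Q \<theta>"
proof -
  have "Q0 S \<eta> s \<theta> < Q0 S \<eta> s y \<longleftrightarrow> quad_cost S \<eta> y < quad_cost S \<eta> \<theta>" for y
    using s by (simp add: Q0_bracket bracket_eq_quad_cost divide_strict_right_mono
        divide_less_cancel)
  thus ?thesis by (simp add: is_arg_max_def is_arg_min_def)
qed

end

section \<open>Linear parametrization and the closed form\<close>

text \<open>\<open>M\<close> sends the numerator entries to the rows from 0 on and the denominator
  entries to the rows from \<open>nsamp S\<close> on; all other rows are zero padding. The length
  bounds ensure that no parameter is cut off.\<close>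

lemma g_ji_linear:
  assumes num: "nnum S \<le> nsamp S" and den: "nden S \<le> nsamp S"
  defines "M \<equiv> mat (2 * nsamp S) (n_theta S) (\<lambda>(r, c).
    if r < nsamp S \<and> c < nnum S \<and> c = r \<or> nsamp S \<le> r \<and> nnum S \<le> c \<and> r - nsamp S = c - nnum S
    then 1 else 0 :: real)"
  assumes \<theta>: "\<theta> \<in> carrier_vec (n_theta S)"
  shows "g_ji S \<theta> = M *\<^sub>v \<theta>"
proof (rule eq_vecI)
  fix r assume "r < dim_vec (M *\<^sub>v \<theta>)"
  hence r: "r < 2 * nsamp S" by (simp add: M_def)
  \<comment> \<open>Row \<open>r\<close> can have its 1 only in column \<open>c\<close>. The flag
    \<open>a\<close> excludes padding rows, where \<open>c\<close> may still be a valid column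
    belonging to another parameter.\<close>
  define c where "c = (if r < nsamp S then r else nnum S + (r - nsamp S))"
  define a where "a \<longleftrightarrow> (if r < nsamp S then r < nnum S else r - nsamp S < nden S)"
  have "(M *\<^sub>v \<theta>) $ r = (\<Sum>d\<in>{0..<n_theta S}. M $$ (r, d) * \<theta> $ d)"
    using r \<theta> by (simp add: M_def scalar_prod_def)
  also have "\<dots> = (\<Sum>d\<in>{0..<n_theta S}. if d = c then (if a then \<theta> $ d else 0) else 0)"
    using r by (intro sum.cong) (auto simp: M_def c_def a_def n_theta_def)
  also have "\<dots> = g_ji S \<theta> $ r"
    using r \<theta> num den
    by (auto simp: g_ji_def b_ji_def f_ji_def resize_vec_def vec_first_def vec_last_def
        c_def a_def n_theta_def)
  finally show "g_ji S \<theta> $ r = (M *\<^sub>v \<theta>) $ r" by simp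
qed (simp add: M_def g_ji_def b_ji_def f_ji_def resize_vec_def)

text \<open>The closed form appears twice because stationarity sees only the symmetric part of the
  normal matrix; the formula with the matrix itself is the symmetric case.\<close>

theorem theorem2:
  fixes S :: "'v setup_data" and Nj :: "'v set" and \<eta> :: "'v hyperparams"
  assumes "nsamp S > 0" and "irlen S > 0"
    and "nnum S \<le> nsamp S" and "nden S \<le> nsamp S"
    and "finite Nj" and "outn S \<notin> Nj" and "inn S \<in> Nj"
    and "distinct (others S)" and "set (others S) = Nj - {inn S}"
    and "theta \<eta> \<in> carrier_vec (n_theta S)"
    and "\<And>k. k \<in> insert (outn S) (set (others S)) \<Longrightarrow> 0 \<le> lam \<eta> k \<and> 0 \<le> bet \<eta> k \<and> bet \<eta> k < 1"
    and "sigma2 \<eta> > 0"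
    and "invertible_mat (K_mat S \<eta>)"
  shows "\<exists>M \<in> carrier_mat (2 * nsamp S) (n_theta S).
      (\<forall>r < 2 * nsamp S. \<forall>c < n_theta S. M $$ (r, c) \<in> {0, 1}) \<and>
      (\<forall>\<theta> \<in> carrier_vec (n_theta S). g_ji S \<theta> = M *\<^sub>v \<theta>) \<and>
      (\<forall>s > 0. \<forall>\<theta>. is_arg_max (Q0 S \<eta> s) (\<lambda>t. t \<in> carrier_vec (n_theta S)) \<theta> \<longleftrightarrow>
          is_arg_min (quad_cost S \<eta>) (\<lambda>t. t \<in> carrier_vec (n_theta S)) \<theta>) \<and>
      (invertible_mat (sym_part (M\<^sup>T * A_hat S \<eta> * M)) \<longrightarrow>
        (\<forall>\<theta>. is_arg_min (quad_cost S \<eta>) (\<lambda>t. t \<in> carrier_vec (n_theta S)) \<theta> \<longleftrightarrow>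
          \<theta> = minv (sym_part (M\<^sup>T * A_hat S \<eta> * M)) *\<^sub>v (M\<^sup>T *\<^sub>v b_hat S \<eta>))) \<and>
      (invertible_mat (M\<^sup>T * A_hat S \<eta> * M) \<and>
       (M\<^sup>T * A_hat S \<eta> * M)\<^sup>T = M\<^sup>T * A_hat S \<eta> * M \<longrightarrow>
        (\<forall>\<theta>. is_arg_min (quad_cost S \<eta>) (\<lambda>t. t \<in> carrier_vec (n_theta S)) \<theta> \<longleftrightarrow>
          \<theta> = minv (M\<^sup>T * A_hat S \<eta> * M) *\<^sub>v (M\<^sup>T *\<^sub>v b_hat S \<eta>)))"
proof -
  interpret identification_setup S \<eta>
    by unfold_locales (use assms in auto)
  define M :: "real mat" where "M = mat (2 * nsamp S) (n_theta S) (\<lambda>(r, c).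
    if r < nsamp S \<and> c < nnum S \<and> c = r \<or> nsamp S \<le> r \<and> nnum S \<le> c \<and> r - nsamp S = c - nnum S
    then 1 else 0)"
  let ?k = "n_theta S"
  have M: "M \<in> carrier_mat (N + N) ?k" by (simp add: M_def mult_2)
  have g: "g_ji S \<theta> = M *\<^sub>v \<theta>" if "\<theta> \<in> carrier_vec ?k" for \<theta>
    unfolding M_def by (rule g_ji_linear[OF assms(3,4) that])
  let ?A = "M\<^sup>T * A_hat S \<eta> * M" and ?b = "M\<^sup>T *\<^sub>v b_hat S \<eta>"
  note Ah = A_hat_carrier and bh = b_hat_carrier
  have Mt: "M\<^sup>T \<in> carrier_mat ?k (N + N)" using M by simp
  have AM: "A_hat S \<eta> * M \<in> carrier_mat (N + N) ?k" using Ah M by simp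
  have A: "?A \<in> carrier_mat ?k ?k" using Mt Ah M by auto
  have sA: "sym_part ?A \<in> carrier_mat ?k ?k" using A by (auto simp: sym_part_def)
  have sAt: "(sym_part ?A)\<^sup>T = sym_part ?A"
    using A by (auto simp: sym_part_def intro!: eq_matI)
  have b: "?b \<in> carrier_vec ?k" using Mt bh by simp
  \<comment> \<open>The cost pulled back along \<open>M\<close>, with its matrix symmetrized so that
    the minimization lemma applies.\<close>
  have cost: "quad_cost S \<eta> x = x \<bullet> (sym_part ?A *\<^sub>v x) - 2 * (?b \<bullet> x)" if x: "x \<in> carrier_vec ?k" for x
  proof -
    have "x \<bullet> (sym_part ?A *\<^sub>v x) = x \<bullet> ((M\<^sup>T * (A_hat S \<eta> * M)) *\<^sub>v x)"
      by (simp only: scalar_prod_sym_part[OF A x]) (simp only: assoc_mult_mat[OF Mt Ah M])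
    also have "\<dots> = (M *\<^sub>v x) \<bullet> (A_hat S \<eta> *\<^sub>v (M *\<^sub>v x))"
      unfolding scalar_prod_transpose_mult[OF M AM x x] assoc_mult_mat_vec[OF Ah M x] ..
    finally show ?thesis
      unfolding quad_cost_def g[OF x] transpose_vec_mult_scalar[OF M x bh] by simp
  qed
  \<comment> \<open>The bracket is nonnegative and differs from the cost by a constant; minus that
    constant is the lower bound.\<close>
  have bdd: "- (w_out S \<bullet> w_out S - 2 * (w_out S \<bullet> (X *\<^sub>v m)) + trace_form X X) \<le> quad_cost S \<eta> x" for x
    using bracket_nonneg[of x] unfolding bracket_eq_quad_cost by linarith
  have min: "is_arg_min (quad_cost S \<eta>) (\<lambda>t. t \<in> carrier_vec ?k) \<theta> \<longleftrightarrow> \<theta> = minv (sym_part ?A) *\<^sub>v ?b"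
    if "invertible_mat (sym_part ?A)" for \<theta>
    by (rule is_arg_min_quadratic_iff[OF sA sAt that b cost bdd])
  have sym: "sym_part ?A = ?A" if "?A\<^sup>T = ?A"
    using A unfolding sym_part_def that by (auto intro!: eq_matI)
  show ?thesis
  proof (intro bexI[of _ M] conjI)
    show "\<forall>r < 2 * N. \<forall>c < ?k. M $$ (r, c) \<in> {0, 1}" by (simp add: M_def)
    show "M \<in> carrier_mat (2 * N) ?k" using M by (simp add: mult_2)
    show "invertible_mat ?A \<and> ?A\<^sup>T = ?A \<longrightarrow> (\<forall>\<theta>. is_arg_min (quad_cost S \<eta>) (\<lambda>t. t \<in> carrier_vec ?k) \<theta>
        \<longleftrightarrow> \<theta> = minv ?A *\<^sub>v ?b)"
      using min sym by metis
  qed (use g min is_arg_max_Q0_iff in auto)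
qed

end
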